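(* Let $1<p<\infty$ and $q=\frac{p}{p-1}$. (i) If $A\in(\ell_p(\Delta^{(\tilde\alpha)}),\ell_\infty)$, then $L_A$ is compact if and only if $$\lim_{r\to\infty}\sup_n\Big(\sum_{k=r+1}^\infty|\hat a_{nk}|^q\Big)^{1/q}=0.$$ (ii) If $A\in(\ell_1(\Delta^{(\tilde\alpha)}),\ell_\infty)$, then $L_A$ is compact if and only if $$\lim_{m\to\infty}\sup_{0\le n\le m}|\hat a_{n,k_1}-\hat a_{n,k_2}|=\sup_{n\ge 0}|\hat a_{n,k_1}-\hat a_{n,k_2}|$$ uniformly in $k_1$ and $k_2$ ($0\le k_1,k_2<\infty$).
   Context: $\omega$ is the set of all complex sequences $x=(x_k)_{k\ge0}$; $\ell_\infty$ carries the sup norm and $\ell_p$ ($1\le p<\infty$) its usual norm. Fix a fraction $\tilde\alpha$ (a real non-integer number). For $x\in\omega$ put $$(\Delta^{(\tilde\alpha)}x)_k=\sum_{i=0}^{k}(-1)^i\frac{\Gamma(\tilde\alpha+1)}{i!\,\Gamma(\tilde\alpha-i+1)}x_{k-i}$$ (terms with negative index are zero). For $1\le p<\infty$, $\ell_p(\Delta^{(\tilde\alpha)})=\{x\in\omega:\Delta^{(\tilde\alpha)}x\in\ell_p\}$, a Banach space with norm $\|x\|=\|\Delta^{(\tilde\alpha)}x\|_{\ell_p}$. For an infinite complex matrix $A=(a_{nk})_{n,k\ge0}$ and $X,Y\subset\omega$, $A\in(X,Y)$ means that for every $x\in X$ the series $A_nx=\sum_{k=0}^\infty a_{nk}x_k$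 converges for all $n$ and $Ax=(A_nx)_{n\ge0}\in Y$. $L_A:X\to Y$ denotes the (bounded) operator $L_A(x)=Ax$. The matrix $\hat A=(\hat a_{nk})$ associated with $A$ is $$\hat a_{nk}=\sum_{j=k}^\infty(-1)^{j-k}\frac{\Gamma(-\tilde\alpha+1)}{(j-k)!\,\Gamma(-\tilde\alpha-j+k+1)}a_{nj}$$ (these series converge whenever $A$ maps $\ell_p(\Delta^{(\tilde\alpha)})$ into some subset of $\omega$). *)

theory Defs
  imports "HOL-Analysis.Analysis"
begin

text \<open>
  Sequences are functions \<^typ>\<open>nat \<Rightarrow> complex\<close>. As the exponent \<open>p\<close> is a variable, sequence spaces
  are rendered as carrier sets together with separate norm functions, which are meaningful only
  on their carriers.
\<close>

type_synonym cseq = "nat \<Rightarrow> complex"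

type_synonym cmatrix = "nat \<Rightarrow> nat \<Rightarrow> complex"

definition lp :: "real \<Rightarrow> cseq set" where
  "lp p = {x. summable (\<lambda>k. norm (x k) powr p)}"

definition lp_norm :: "real \<Rightarrow> cseq \<Rightarrow> real" where
  "lp_norm p x = (\<Sum>k. norm (x k) powr p) powr (1 / p)"

definition linf :: "cseq set" where
  "linf = {x. bounded (range x)}"

definition linf_norm :: "cseq \<Rightarrow> real" where
  "linf_norm x = (SUP k. norm (x k))"

text \<open>
  The coefficients of the difference operator of fractional order \<open>\<alpha>\<close>. For non-integral \<open>\<alpha>\<close> neither
  argument of \<^const>\<open>Gamma\<close> is a pole, so its totalised value there plays no role.
\<close>

definition frac_coeff :: "real \<Rightarrow> nat \<Rightarrow> real" where
  "frac_coeff \<alpha> i = (-1) ^ i * (Gamma (\<alpha> + 1) / (fact i * Gamma (\<alpha> - real i + 1)))"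

definition frac_diff :: "real \<Rightarrow> cseq \<Rightarrow> cseq" where
  "frac_diff \<alpha> x = (\<lambda>k. \<Sum>i=0..k. complex_of_real (frac_coeff \<alpha> i) * x (k - i))"

definition lp_diff :: "real \<Rightarrow> real \<Rightarrow> cseq set" where
  "lp_diff \<alpha> p = {x. frac_diff \<alpha> x \<in> lp p}"

definition lp_diff_norm :: "real \<Rightarrow> real \<Rightarrow> cseq \<Rightarrow> real" where
  "lp_diff_norm \<alpha> p x = lp_norm p (frac_diff \<alpha> x)"

definition mat_op :: "cmatrix \<Rightarrow> cseq \<Rightarrow> cseq" where
  "mat_op A x = (\<lambda>n. \<Sum>k. A n k * x k)"

definition mat_class :: "cseq set \<Rightarrow> cseq set \<Rightarrow> cmatrix set" where
  "mat_class X Y =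
     {A. \<forall>x\<in>X. (\<forall>n. summable (\<lambda>k. A n k * x k)) \<and> mat_op A x \<in> Y}"

text \<open>
  The series over \<open>j \<ge> k\<close> is indexed by \<open>i = j - k\<close>. It need not converge absolutely, so it is
  taken as the limit of its partial sums.
\<close>

definition hat_mat :: "real \<Rightarrow> cmatrix \<Rightarrow> cmatrix" where
  "hat_mat \<alpha> A = (\<lambda>n k. \<Sum>i. complex_of_real (frac_coeff (-\<alpha>) i) * A n (k + i))"

text \<open>
  Compactness of a (linear) operator \<open>T\<close> from \<open>X\<close> with norm \<open>nX\<close> to \<open>Y\<close> with norm \<open>nY\<close>: it is
  defined on all of \<open>X\<close>, and the image of every bounded sequence in \<open>X\<close> has a subsequence
  converging in \<open>Y\<close>.
\<close>

definition compact_operator ::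
  "cseq set \<Rightarrow> (cseq \<Rightarrow> real) \<Rightarrow> cseq set \<Rightarrow> (cseq \<Rightarrow> real) \<Rightarrow> (cseq \<Rightarrow> cseq) \<Rightarrow> bool" where
  "compact_operator X nX Y nY T \<longleftrightarrow>
     T ` X \<subseteq> Y \<and>
     (\<forall>x :: nat \<Rightarrow> cseq. (\<forall>n. x n \<in> X) \<and> (\<exists>C. \<forall>n. nX (x n) \<le> C) \<longrightarrow>
        (\<exists>r :: nat \<Rightarrow> nat. \<exists>y\<in>Y. strict_mono r \<and>
           (\<lambda>n. nY (\<lambda>k. T (x (r n)) k - y k)) \<longlonglongrightarrow> 0))"

end

theory Submission
  imports Defs
begin

text \<open>
  As \<open>\<Delta>\<^sup>(\<^sup>\<alpha>\<^sup>)\<close> is convolution with the coefficients of \<open>(1 - z)\<^sup>\<alpha>\<close>, it is inverted by \<open>\<Delta>\<^sup>(\<^sup>-\<^sup>\<alpha>\<^sup>)\<close>. With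
  \<open>y = \<Delta>\<^sup>(\<^sup>\<alpha>\<^sup>) x\<close> the rows of \<open>A\<close> become functionals on \<open>\<ell>\<^sub>p\<close> that are continuous by uniform boundedness;
  their values at the unit vectors are the entries of the associated matrix, so everything reduces
  to a matrix \<open>b\<close> that maps \<open>\<ell>\<^sub>p\<close> boundedly into \<open>\<ell>\<^sub>\<infinity>\<close>.

  For \<open>p > 1\<close>, small tails let finitely many coordinates of \<open>y\<close> control \<open>b y\<close>; if the tails are not
  small, unit vectors running off to infinity have images bounded away from \<open>0\<close> that tend to \<open>0\<close>
  coordinatewise. For \<open>p = 1\<close>, the condition means that finitely many rows detect the distances
  between the columns, which amounts to total boundedness of the set of columns.
\<close>

section \<open>The spaces of p-summable sequences\<close>

text \<open>For positive \<open>s\<close> and \<open>t\<close> this is convexity on the open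
  half-line. If one of them is 0, it reduces to \<open>w powr p \<le> w\<close> for \<open>w\<close>
  in [0, 1].\<close>

lemma powr_convex_nonneg:
  fixes u v s t p :: real
  assumes "1 \<le> p" "0 \<le> u" "0 \<le> v" "u + v = 1" "0 \<le> s" "0 \<le> t"
  shows "(u * s + v * t) powr p \<le> u * s powr p + v * t powr p"
proof -
  have scale: "(w * r) powr p \<le> w * r powr p" if "0 \<le> w" "w \<le> 1" "0 \<le> r" for w r :: real
  proof -
    have "w powr p \<le> w"
      using powr_mono'[of 1 p w] that assms(1) by (cases "w = 0") auto
    then show ?thesis
      using that by (simp add: powr_mult mult_right_mono)
  qed
  consider "s = 0" | "t = 0" | "0 < s" "0 < t"
    using assms by linarith
  then show ?thesis
  proof cases
    case 3
    then show ?thesis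
      using convex_onD[OF powr_convex[OF assms(1)], of v s t] assms by (simp add: eq_diff_eq[symmetric])
  qed (use scale assms in auto)
qed

section \<open>The norm of \<open>l_p\<close> and Minkowski's inequality\<close>

lemma lp_norm_nonneg [simp]: "0 \<le> lp_norm p x"
  by (simp add: lp_norm_def)

lemma lp_norm_powr:
  assumes "0 < p" "x \<in> lp p"
  shows "lp_norm p x powr p = (\<Sum>k. norm (x k) powr p)"
  using assms by (simp add: lp_norm_def lp_def powr_powr suminf_nonneg)

lemma lp_sum_le:
  assumes "0 < p" "x \<in> lp p" "finite F"
  shows "(\<Sum>k\<in>F. norm (x k) powr p) \<le> lp_norm p x powr p"
  unfolding lp_norm_powr[OF assms(1,2)]
  using assms by (intro sum_le_suminf) (auto simp: lp_def)

lemma lp_norm_coord: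
  assumes "0 < p" "x \<in> lp p"
  shows "norm (x k) \<le> lp_norm p x"
proof -
  have "norm (x k) powr p \<le> lp_norm p x powr p"
    using lp_sum_le[OF assms, of "{k}"] by simp
  then show ?thesis
    using assms(1) powr_less_mono2[of p "lp_norm p x" "norm (x k)"] by force
qed

lemma lp_norm_leI:
  assumes "0 < p" "0 \<le> C" "\<And>N. (\<Sum>k<N. norm (x k) powr p) \<le> C powr p"
  shows "x \<in> lp p" "lp_norm p x \<le> C"
proof -
  have summ: "summable (\<lambda>k. norm (x k) powr p)"
    using assms(3) by (intro summableI_nonneg_bounded[where x = "C powr p"]) auto
  then show "x \<in> lp p"
    by (simp add: lp_def)
  have "(\<Sum>k. norm (x k) powr p) \<le> C powr p"
    using assms(3) by (intro suminf_le_const summ) auto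
  then have "lp_norm p x \<le> (C powr p) powr (1 / p)"
    unfolding lp_norm_def using assms summ by (intro powr_mono2) (auto simp: suminf_nonneg)
  then show "lp_norm p x \<le> C"
    using assms by (simp add: powr_powr)
qed

text \<open>Minkowski's inequality. For nonzero norms a and b, the vector (x + y) / (a + b) is the
  convex combination of x / a and y / b with weights \<open>u\<close> and \<open>v\<close>.
  Convexity of the p-th power bounds its partial sums by \<open>u + v = 1\<close>.\<close>

lemma
  assumes "1 \<le> p" "x \<in> lp p" "y \<in> lp p"
  shows lp_add: "(\<lambda>k. x k + y k) \<in> lp p"
    and lp_norm_triangle: "lp_norm p (\<lambda>k. x k + y k) \<le> lp_norm p x + lp_norm p y"
proof -
  have p: "0 < p" using assms by simp
  let ?a = "lp_norm p x" and ?b = "lp_norm p y"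
  have zero: "z k = 0" if "z \<in> lp p" "lp_norm p z = 0" for z k
    using lp_norm_coord[OF p that(1), of k] that(2) by simp
  have "(\<lambda>k. x k + y k) \<in> lp p \<and> lp_norm p (\<lambda>k. x k + y k) \<le> ?a + ?b"
  proof (cases "?a = 0 \<or> ?b = 0")
    case True
    then consider "x = (\<lambda>k. 0)" | "y = (\<lambda>k. 0)"
      using zero assms by blast
    then show ?thesis
      using assms by cases auto
  next
    case False
    then have ab: "0 < ?a" "0 < ?b"
      by (auto simp: less_le)
    define u v where "u = ?a / (?a + ?b)" and "v = ?b / (?a + ?b)"
    have uv: "0 < u" "0 < v" "u + v = 1"
      using ab by (auto simp: u_def v_def add_divide_distrib[symmetric])
    have ptw: "norm (x k + y k) powr p
        \<le> (?a + ?b) powr p * (u * (norm (x k) / ?a) powr p + v * (norm (y k) / ?b) powr p)" for k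
    proof -
      have "norm (x k + y k) \<le> (?a + ?b) * (u * (norm (x k) / ?a) + v * (norm (y k) / ?b))"
      proof -
        have "(?a + ?b) * (u * (norm (x k) / ?a) + v * (norm (y k) / ?b)) = norm (x k) + norm (y k)"
          using ab by (simp add: u_def v_def distrib_left)
        then show ?thesis
          using norm_triangle_ineq[of "x k" "y k"] by simp
      qed
      then have "norm (x k + y k) powr p
          \<le> ((?a + ?b) * (u * (norm (x k) / ?a) + v * (norm (y k) / ?b))) powr p"
        using p by (intro powr_mono2) auto
      also have "\<dots> = (?a + ?b) powr p * (u * (norm (x k) / ?a) + v * (norm (y k) / ?b)) powr p"
        using ab uv by (simp add: powr_mult)
      also have "\<dots> \<le> (?a + ?b) powr p * (u * (norm (x k) / ?a) powr p + v * (norm (y k) / ?b) powr p)"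
        using ab uv assms(1) by (intro mult_left_mono powr_convex_nonneg) auto
      finally show ?thesis .
    qed
    have le1: "(\<Sum>k<N. (norm (z k) / c) powr p) \<le> 1" if "z \<in> lp p" "lp_norm p z = c" "0 < c" for N z c
      using lp_sum_le[OF p that(1), of "{..<N}"] that
      by (simp add: powr_divide sum_divide_distrib[symmetric])
    have "(\<Sum>k<N. norm (x k + y k) powr p) \<le> (?a + ?b) powr p" for N
    proof -
      have "(\<Sum>k<N. norm (x k + y k) powr p) \<le>
          (\<Sum>k<N. (?a + ?b) powr p * (u * (norm (x k) / ?a) powr p + v * (norm (y k) / ?b) powr p))"
        by (intro sum_mono ptw)
      also have "\<dots> = (?a + ?b) powr p * (u * (\<Sum>k<N. (norm (x k) / ?a) powr p)
          + v * (\<Sum>k<N. (norm (y k) / ?b) powr p))"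
        by (simp add: sum_distrib_left[symmetric] sum.distrib)
      also have "\<dots> \<le> (?a + ?b) powr p * (u * 1 + v * 1)"
        using uv ab le1[OF assms(2)] le1[OF assms(3)]
        by (intro mult_left_mono add_mono) auto
      finally show ?thesis using uv by simp
    qed
    then show ?thesis
      using lp_norm_leI[OF p, of "?a + ?b"] by simp
  qed
  then show "(\<lambda>k. x k + y k) \<in> lp p" "lp_norm p (\<lambda>k. x k + y k) \<le> ?a + ?b"
    by auto
qed

lemma lp_scale:
  assumes "0 < p" "x \<in> lp p"
  shows "(\<lambda>k. c * x k) \<in> lp p"
    and lp_norm_scale: "lp_norm p (\<lambda>k. c * x k) = norm c * lp_norm p x"
proof -
  have s: "summable (\<lambda>k. norm (x k) powr p)"
    using assms by (simp add: lp_def)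
  have eq: "norm (c * x k) powr p = norm c powr p * norm (x k) powr p" for k
    by (simp add: norm_mult powr_mult)
  show "(\<lambda>k. c * x k) \<in> lp p"
    unfolding lp_def mem_Collect_eq eq using s by (rule summable_mult)
  show "lp_norm p (\<lambda>k. c * x k) = norm c * lp_norm p x"
    unfolding lp_norm_def eq using assms s
    by (simp add: suminf_mult powr_mult powr_powr suminf_nonneg)
qed

lemma
  assumes "1 \<le> p" "x \<in> lp p" "y \<in> lp p"
  shows lp_minus: "(\<lambda>k. x k - y k) \<in> lp p"
    and lp_norm_minus_le: "lp_norm p (\<lambda>k. x k - y k) \<le> lp_norm p x + lp_norm p y"
proof -
  have p: "0 < p" using assms by simp
  have y: "(\<lambda>k. - 1 * y k) \<in> lp p" "lp_norm p (\<lambda>k. - 1 * y k) = lp_norm p y"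
    using lp_scale[OF p assms(3), of "- 1"] lp_norm_scale[OF p assms(3), of "- 1"] by auto
  show "(\<lambda>k. x k - y k) \<in> lp p"
    using lp_add[OF assms(1,2) y(1)] by simp
  show "lp_norm p (\<lambda>k. x k - y k) \<le> lp_norm p x + lp_norm p y"
    using lp_norm_triangle[OF assms(1,2) y(1)] y(2) by simp
qed

section \<open>Finite supports, limits and tails\<close>

lemma lp_finite_support:
  assumes "0 < p" "finite F" "\<And>k. k \<notin> F \<Longrightarrow> x k = 0"
  shows "x \<in> lp p" "lp_norm p x = (\<Sum>k\<in>F. norm (x k) powr p) powr (1 / p)"
proof -
  have "(\<lambda>k. norm (x k) powr p) sums (\<Sum>k\<in>F. norm (x k) powr p)"
    using assms by (intro sums_finite) auto
  then show "x \<in> lp p" "lp_norm p x = (\<Sum>k\<in>F. norm (x k) powr p) powr (1 / p)"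
    by (auto simp: lp_def lp_norm_def sums_iff)
qed

lemma lp_zero: "0 < p \<Longrightarrow> (\<lambda>k. 0) \<in> lp p" "0 < p \<Longrightarrow> lp_norm p (\<lambda>k. 0) = 0"
  by (auto simp: lp_def lp_norm_def)

lemma lp_unit:
  assumes "0 < p"
  shows "(\<lambda>j. if j = k then 1 else 0) \<in> lp p" "lp_norm p (\<lambda>j. if j = k then 1 else 0) = 1"
  using lp_finite_support[OF assms, of "{k}" "\<lambda>j. if j = k then 1 else 0"] by auto

text \<open>A discrete Fatou lemma: finite partial sums are continuous in the coordinates, so their
  bound survives the limit. It supplies membership of coordinatewise limits in the completeness
  argument.\<close>

lemma lp_Fatou:
  assumes "0 < p" "0 \<le> C" "\<And>s. x s \<in> lp p" "\<And>s. lp_norm p (x s) \<le> C"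
    and "\<And>k. (\<lambda>s. x s k) \<longlonglongrightarrow> X k"
  shows "X \<in> lp p" "lp_norm p X \<le> C"
proof -
  have "(\<Sum>k<N. norm (X k) powr p) \<le> C powr p" for N
  proof (rule LIMSEQ_le_const2)
    show "(\<lambda>s. \<Sum>k<N. norm (x s k) powr p) \<longlonglongrightarrow> (\<Sum>k<N. norm (X k) powr p)"
      using assms by (intro tendsto_sum tendsto_powr' tendsto_norm tendsto_const) auto
    have "(\<Sum>k<N. norm (x s k) powr p) \<le> C powr p" for s
      using lp_sum_le[OF assms(1) assms(3), of "{..<N}" s] powr_mono2[OF _ _ assms(4), of p s] assms(1)
      by force
    then show "\<exists>M. \<forall>s\<ge>M. (\<Sum>k<N. norm (x s k) powr p) \<le> C powr p"
      by blast
  qed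
  then show "X \<in> lp p" "lp_norm p X \<le> C"
    using lp_norm_leI[OF assms(1,2)] by auto
qed

lemma lp_shift:
  assumes "0 < p" "x \<in> lp p"
  shows "(\<lambda>k. x (N + k)) \<in> lp p" "lp_norm p (\<lambda>k. x (N + k)) \<le> lp_norm p x"
proof -
  have "(\<Sum>k<M. norm (x (N + k)) powr p) \<le> lp_norm p x powr p" for M
  proof -
    have "(\<Sum>k<M. norm (x (N + k)) powr p) = (\<Sum>k\<in>(+) N ` {..<M}. norm (x k) powr p)"
      by (subst sum.reindex) auto
    then show ?thesis
      using lp_sum_le[OF assms, of "(+) N ` {..<M}"] by simp
  qed
  then show "(\<lambda>k. x (N + k)) \<in> lp p" "lp_norm p (\<lambda>k. x (N + k)) \<le> lp_norm p x"
    using lp_norm_leI[OF assms(1), of "lp_norm p x" "\<lambda>k. x (N + k)"] by auto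
qed

lemma lp_tail_tendsto_0:
  assumes "0 < p" "x \<in> lp p"
  shows "(\<lambda>N. lp_norm p (\<lambda>k. x (N + k))) \<longlonglongrightarrow> 0"
proof -
  have "summable (\<lambda>k. norm (x k) powr p)"
    using assms by (simp add: lp_def)
  from suminf_exist_split2[OF this]
  have "(\<lambda>N. \<Sum>k. norm (x (N + k)) powr p) \<longlonglongrightarrow> 0"
    by (simp add: add.commute)
  then have "(\<lambda>N. (\<Sum>k. norm (x (N + k)) powr p) powr (1 / p)) \<longlonglongrightarrow> 0 powr (1 / p)"
    using assms lp_shift[OF assms] by (intro tendsto_powr' tendsto_const)
      (auto simp: lp_def suminf_nonneg)
  then show ?thesis
    by (simp add: lp_norm_def)
qed

section \<open>Hoelder's inequality and its converse\<close>

lemma conjugate_exponent: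
  fixes p q :: real
  assumes "1 < p" "q = p / (p - 1)"
  shows "0 < p" "0 < q" "1 < q" "(q - 1) * p = q" "1 / q + 1 / p = 1"
  using assms(1) unfolding assms(2) by (auto simp: field_simps)

text \<open>Divide both sequences by their norms and apply Young's inequality termwise: the partial
  sums are then at most 1/q + 1/p = 1.\<close>

lemma lp_Hoelder:
  assumes "1 < p" "q = p / (p - 1)" "x \<in> lp q" "y \<in> lp p"
  shows "summable (\<lambda>k. x k * y k)" "norm (\<Sum>k. x k * y k) \<le> lp_norm q x * lp_norm p y"
proof -
  note p = conjugate_exponent(1)[OF assms(1,2)] and q = conjugate_exponent(3,2)[OF assms(1,2)]
    and pq = conjugate_exponent(5)[OF assms(1,2)]
  let ?a = "lp_norm q x" and ?b = "lp_norm p y"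
  have fin: "(\<Sum>k<N. norm (x k * y k)) \<le> ?a * ?b" for N
  proof (cases "?a = 0 \<or> ?b = 0")
    case True
    then have eq: "x k * y k = 0" for k
      using lp_norm_coord[OF q(2) assms(3), of k] lp_norm_coord[OF p assms(4), of k] by auto
    show ?thesis
      unfolding eq by simp
  next
    case False
    then have ab: "0 < ?a" "0 < ?b"
      by (auto simp: less_le)
    have le1: "(\<Sum>k<N. (norm (z k) / c) powr r) \<le> 1" if "0 < r" "z \<in> lp r" "lp_norm r z = c" "0 < c" for r z c
      using lp_sum_le[OF that(1,2), of "{..<N}"] that
      by (simp add: powr_divide sum_divide_distrib[symmetric])
    have "(\<Sum>k<N. norm (x k * y k)) / (?a * ?b)
        = (\<Sum>k<N. (norm (x k) / ?a) * (norm (y k) / ?b))"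
      by (simp add: sum_divide_distrib norm_mult)
    also have "\<dots> \<le> (\<Sum>k<N. (norm (x k) / ?a) powr q / q + (norm (y k) / ?b) powr p / p)"
      using ab pq q assms(1) by (intro sum_mono Youngs_inequality) auto
    also have "\<dots> = (\<Sum>k<N. (norm (x k) / ?a) powr q) / q + (\<Sum>k<N. (norm (y k) / ?b) powr p) / p"
      by (simp add: sum.distrib sum_divide_distrib)
    also have "\<dots> \<le> 1 / q + 1 / p"
      using le1[OF q(2) assms(3) refl ab(1)] le1[OF p assms(4) refl ab(2)] p q
      by (intro add_mono divide_right_mono) auto
    finally show ?thesis
      using ab unfolding pq by (simp add: pos_divide_le_eq)
  qed
  then have summ: "summable (\<lambda>k. norm (x k * y k))"
    by (intro summableI_nonneg_bounded) auto
  then show "summable (\<lambda>k. x k * y k)"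
    by (rule summable_norm_cancel)
  show "norm (\<Sum>k. x k * y k) \<le> ?a * ?b"
    using summable_norm[OF summ] suminf_le_const[OF summ fin] by simp
qed

text \<open>Testing \<open>x\<close> on an extremal \<open>y\<close> supported below
  \<open>N\<close> gives \<open>S \<le> M * S powr (1 / p)\<close> for the partial sum
  \<open>S\<close>, hence \<open>S powr (1 / q) \<le> M\<close>. Only finite sums occur, so
  \<open>x\<close> may be tested before it is known to lie in \<open>lp q\<close>.\<close>

lemma lp_dual_norm_leI:
  assumes "1 < p" "q = p / (p - 1)" "0 \<le> M"
    and "\<And>N y. (\<And>k. N \<le> k \<Longrightarrow> y k = 0) \<Longrightarrow> norm (\<Sum>k<N. x k * y k) \<le> M * lp_norm p y"
  shows "x \<in> lp q" "lp_norm q x \<le> M"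
proof -
  note p = conjugate_exponent(1)[OF assms(1,2)] and q = conjugate_exponent(3,2)[OF assms(1,2)]
    and pq = conjugate_exponent(4,5)[OF assms(1,2)]
  have "(\<Sum>k<N. norm (x k) powr q) \<le> M powr q" for N
  proof -
    define S where "S = (\<Sum>k<N. norm (x k) powr q)"
    \<comment> \<open>The equality case of Hoelder's inequality: the phases cancel those of
      \<open>x\<close>, and (q - 1) p = q turns the p-th powers of |y k| into q-th powers of |x
      k|.\<close>
    define y where "y k = (if k < N then cnj (sgn (x k)) * of_real (norm (x k) powr (q - 1)) else 0)" for k
    have "x k * cnj (sgn (x k)) = of_real (norm (x k))" for k
      by (simp add: sgn_div_norm scaleR_conv_of_real complex_norm_square[symmetric] field_simps power2_eq_square)
    then have "x k * y k = of_real (norm (x k) powr q)" if "k < N" for k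
      using that powr_mult_base[of "norm (x k)" "q - 1"] 
      by (simp add: y_def mult.assoc[symmetric] of_real_mult[symmetric] del: of_real_mult)
    then have "(\<Sum>k<N. x k * y k) = of_real S"
      unfolding S_def of_real_sum by (intro sum.cong) auto
    moreover have "norm (y k) powr p = norm (x k) powr q" if "k < N" for k
      using that pq q by (cases "x k = 0") (auto simp: y_def norm_mult norm_sgn powr_powr)
    then have "lp_norm p y = S powr (1 / p)"
      using lp_finite_support(2)[OF p, of "{..<N}" y] by (simp add: S_def y_def)
    moreover have "S \<ge> 0"
      by (simp add: S_def sum_nonneg)
    ultimately have "S \<le> M * S powr (1 / p)"
      using assms(4)[of N y] by (simp add: y_def)
    then have "S powr (1 / q) \<le> M"
    proof (cases "S = 0")
      case False
      then have "S > 0" using \<open>S \<ge> 0\<close> by simp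
      have "S powr (1 / q) * S powr (1 / p) = S"
        using \<open>S > 0\<close> pq(2) by (simp add: powr_add[symmetric])
      then have "S powr (1 / q) * S powr (1 / p) \<le> M * S powr (1 / p)"
        using \<open>S \<le> M * S powr (1 / p)\<close> by simp
      then show ?thesis using \<open>S > 0\<close> by simp
    qed (use assms in simp)
    then have "(S powr (1 / q)) powr q \<le> M powr q"
      using q by (intro powr_mono2) auto
    then show ?thesis
      using q \<open>S \<ge> 0\<close> by (simp add: powr_powr S_def)
  qed
  then show "x \<in> lp q" "lp_norm q x \<le> M"
    using lp_norm_leI[OF q(2) assms(3)] by auto
qed

lemma lp_1: "x \<in> lp 1 \<longleftrightarrow> summable (\<lambda>k. norm (x k))"
    and lp_norm_1: "summable (\<lambda>k. norm (x k)) \<Longrightarrow> lp_norm 1 x = (\<Sum>k. norm (x k))"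
  by (simp_all add: lp_def lp_norm_def suminf_nonneg)

section \<open>Uniform boundedness\<close>

text \<open>An element of the dual of \<open>l_p\<close>; the conditions concern the carrier only,
  and the values of \<open>f\<close> elsewhere are arbitrary.\<close>

definition lp_functional :: "real \<Rightarrow> (cseq \<Rightarrow> complex) \<Rightarrow> bool" where
  "lp_functional p f \<longleftrightarrow>
     (\<forall>x\<in>lp p. \<forall>y\<in>lp p. f (\<lambda>k. x k + y k) = f x + f y) \<and>
     (\<forall>c. \<forall>x\<in>lp p. f (\<lambda>k. c * x k) = c * f x) \<and>
     (\<exists>C. \<forall>x\<in>lp p. norm (f x) \<le> C * lp_norm p x)"

lemma lp_functional_add:
  "lp_functional p f \<Longrightarrow> x \<in> lp p \<Longrightarrow> y \<in> lp p \<Longrightarrow> f (\<lambda>k. x k + y k) = f x + f y"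
  by (simp add: lp_functional_def)

lemma lp_functional_scale:
  "lp_functional p f \<Longrightarrow> x \<in> lp p \<Longrightarrow> f (\<lambda>k. c * x k) = c * f x"
  by (simp add: lp_functional_def)

lemma lp_functional_minus:
  assumes "1 \<le> p" "lp_functional p f" "x \<in> lp p" "y \<in> lp p"
  shows "f (\<lambda>k. x k - y k) = f x - f y"
proof -
  have "(\<lambda>k. - 1 * y k) \<in> lp p"
    using assms by (intro lp_scale) auto
  from lp_functional_add[OF assms(2,3) this] show ?thesis
    using lp_functional_scale[OF assms(2,4), of "- 1"] by simp
qed

text \<open>\<open>M\<close> is the operator norm, a supremum over the unit ball that may not be
  attained. The factor 2/3 lies strictly between 1/2 and 1: below 1 it is always reachable, above
  1/2 it outweighs the later humps in the gliding hump argument.\<close>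

lemma lp_functional_norming:
  assumes "1 \<le> p" "lp_functional p f"
  obtains M where "0 \<le> M" "\<And>x. x \<in> lp p \<Longrightarrow> norm (f x) \<le> M * lp_norm p x"
    and "\<And>r. 0 < r \<Longrightarrow> \<exists>h\<in>lp p. lp_norm p h \<le> r \<and> 2 / 3 * r * M \<le> norm (f h)"
proof -
  have p: "0 < p" using assms by simp
  obtain C where C: "\<And>x. x \<in> lp p \<Longrightarrow> norm (f x) \<le> C * lp_norm p x"
    using assms(2) unfolding lp_functional_def by blast
  have scale: "f (\<lambda>k. c * x k) = c * f x" if "x \<in> lp p" for c x
    using assms(2) that by (rule lp_functional_scale)
  define U where "U = {x \<in> lp p. lp_norm p x \<le> 1}"
  define M where "M = (SUP x\<in>U. norm (f x))"
  have zero: "(\<lambda>k. 0) \<in> U"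
    using lp_zero[OF p] by (simp add: U_def)
  have "norm (f x) \<le> \<bar>C\<bar>" if "x \<in> U" for x
  proof -
    have "norm (f x) \<le> \<bar>C\<bar> * lp_norm p x"
      using C[of x] that by (smt (verit) U_def lp_norm_nonneg mem_Collect_eq mult_right_mono)
    also have "\<dots> \<le> \<bar>C\<bar> * 1"
      using that by (intro mult_left_mono) (auto simp: U_def)
    finally show ?thesis by simp
  qed
  then have bdd: "bdd_above ((\<lambda>x. norm (f x)) ` U)"
    by (auto simp: bdd_above_def)
  have M0: "0 \<le> M"
    unfolding M_def by (rule cSUP_upper2[OF bdd zero]) simp
  have bound: "norm (f x) \<le> M * lp_norm p x" if x: "x \<in> lp p" for x
  proof (cases "lp_norm p x = 0")
    case True
    then show ?thesis using C[OF x] by simp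
  next
    case False
    then have pos: "0 < lp_norm p x" by (simp add: less_le)
    let ?c = "complex_of_real (inverse (lp_norm p x))"
    have "(\<lambda>k. ?c * x k) \<in> U"
      using lp_scale[OF p x] lp_norm_scale[OF p x, of ?c] pos by (simp add: U_def norm_inverse)
    then have "norm (f (\<lambda>k. ?c * x k)) \<le> M"
      unfolding M_def using bdd by (intro cSUP_upper)
    then show ?thesis
      using pos unfolding scale[OF x] by (simp add: norm_mult norm_inverse norm_divide field_simps)
  qed
  have "\<exists>h\<in>lp p. lp_norm p h \<le> r \<and> 2 / 3 * r * M \<le> norm (f h)" if r: "0 < r" for r
  proof -
    \<comment> \<open>For \<open>M = 0\<close> there is no strict inequality
      \<open>2 / 3 * M < M\<close>, but the zero sequence serves.\<close>
    have "\<exists>u\<in>U. 2 / 3 * M \<le> norm (f u)"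
    proof (cases "M = 0")
      case False
      then have "2 / 3 * M < (SUP x\<in>U. norm (f x))"
        using M0 by (simp add: M_def[symmetric])
      then show ?thesis
        using less_cSUP_iff[OF _ bdd] zero by (metis empty_iff less_imp_le)
    qed (use zero in auto)
    then obtain u where u: "u \<in> lp p" "lp_norm p u \<le> 1" "2 / 3 * M \<le> norm (f u)"
      by (auto simp: U_def)
    let ?h = "\<lambda>k. complex_of_real r * u k"
    have "?h \<in> lp p"
      by (rule lp_scale[OF p u(1)])
    moreover have "lp_norm p ?h \<le> r"
      using lp_norm_scale[OF p u(1), of "complex_of_real r"] u(2) r by (simp add: mult_left_le)
    moreover have "2 / 3 * r * M \<le> norm (f ?h)"
      using mult_left_mono[OF u(3), of r] r by (simp add: scale[OF u(1)] norm_mult algebra_simps)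
    ultimately show ?thesis by blast
  qed
  with M0 bound show thesis
    using that by blast
qed

text \<open>Completeness of \<open>l_p\<close> with an explicit rate. Each coordinate converges by
  comparison with a geometric series, and the Fatou lemma carries the bounds on the differences over
  to the limit.\<close>

lemma lp_geometric_limit:
  fixes x :: "nat \<Rightarrow> cseq"
  assumes "1 \<le> p" "\<And>s. x s \<in> lp p"
    and "\<And>s. lp_norm p (\<lambda>k. x (Suc s) k - x s k) \<le> (1 / 3) ^ s"
  obtains X where "X \<in> lp p" "\<And>s. lp_norm p (\<lambda>k. X k - x s k) \<le> 3 / 2 * (1 / 3) ^ s"
proof -
  have p: "0 < p" using assms by simp
  \<comment> \<open>The right-hand side is the exact sum of (1/3)^i for s \<le> i < t + s, which
    lets the induction on \<open>t\<close> close.\<close>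
  have diff: "lp_norm p (\<lambda>k. x (t + s) k - x s k) \<le> 3 / 2 * ((1 / 3) ^ s - (1 / 3) ^ (t + s))" for s t
  proof (induction t)
    case 0
    then show ?case using lp_zero[OF p] by simp
  next
    case (Suc t)
    have "lp_norm p (\<lambda>k. (x (Suc (t + s)) k - x (t + s) k) + (x (t + s) k - x s k))
        \<le> lp_norm p (\<lambda>k. x (Suc (t + s)) k - x (t + s) k) + lp_norm p (\<lambda>k. x (t + s) k - x s k)"
      by (intro lp_norm_triangle lp_minus assms)
    also have "\<dots> \<le> (1 / 3) ^ (t + s) + 3 / 2 * ((1 / 3) ^ s - (1 / 3) ^ (t + s))"
      using assms(3) Suc by (intro add_mono)
    finally show ?case by (simp add: field_simps)
  qed
  have diff': "lp_norm p (\<lambda>k. x (t + s) k - x s k) \<le> 3 / 2 * (1 / 3) ^ s" for s t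
  proof -
    have "(0::real) \<le> (1 / 3) ^ (t + s)"
      by simp
    then show ?thesis
      using diff[of t s] by argo
  qed
  have "\<exists>l. (\<lambda>s. x s k) \<longlonglongrightarrow> l" for k
  proof -
    have "summable (\<lambda>s. x (Suc s) k - x s k)"
    proof (rule summable_comparison_test')
      show "summable (\<lambda>s. (1 / 3 :: real) ^ s)"
        by (simp add: summable_geometric)
      show "norm (x (Suc s) k - x s k) \<le> (1 / 3) ^ s" if "0 \<le> s" for s
        using lp_norm_coord[OF p lp_minus[OF assms(1) assms(2)[of "Suc s"] assms(2)[of s]], of k] assms(3)[of s] by simp
    qed
    then have "convergent (\<lambda>s. x s k)"
      unfolding summable_iff_convergent sum_lessThan_telescope[of "\<lambda>s. x s k"] convergent_diff_const_right_iff .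
    then show ?thesis by (simp add: convergent_def)
  qed
  then obtain X where X: "\<And>k. (\<lambda>s. x s k) \<longlonglongrightarrow> X k"
    by metis
  have lim: "(\<lambda>k. X k - x s k) \<in> lp p" "lp_norm p (\<lambda>k. X k - x s k) \<le> 3 / 2 * (1 / 3) ^ s" for s
  proof -
    have "(\<lambda>t. x (t + s) k - x s k) \<longlonglongrightarrow> X k - x s k" for k
      by (intro tendsto_diff tendsto_const LIMSEQ_ignore_initial_segment X)
    from lp_Fatou[OF p _ lp_minus[OF assms(1) assms(2) assms(2)[of s]] diff' this]
    show "(\<lambda>k. X k - x s k) \<in> lp p" "lp_norm p (\<lambda>k. X k - x s k) \<le> 3 / 2 * (1 / 3) ^ s"
      by simp_all
  qed
  then have "X \<in> lp p"
    using lp_add[OF assms(1) lim(1)[of 0] assms(2)[of 0]] by simp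
  with lim(2) show thesis
    using that by blast
qed

text \<open>
  A gliding hump replaces Baire's theorem: by \<open>2 |f h| \<le> |f (x + h)| + |f (x - h)|\<close> one of the two
  signs does not destroy the size of the hump.
\<close>

lemma lp_uniform_boundedness:
  fixes f :: "nat \<Rightarrow> cseq \<Rightarrow> complex"
  assumes "1 \<le> p" "\<And>i. lp_functional p (f i)" "\<And>x. x \<in> lp p \<Longrightarrow> bounded (range (\<lambda>i. f i x))"
  obtains C where "0 \<le> C" "\<And>i x. x \<in> lp p \<Longrightarrow> norm (f i x) \<le> C * lp_norm p x"
proof -
  have p: "0 < p" using assms by simp
  have "\<exists>M. 0 \<le> M \<and> (\<forall>x\<in>lp p. norm (f i x) \<le> M * lp_norm p x) \<and>
      (\<forall>r>0. \<exists>h\<in>lp p. lp_norm p h \<le> r \<and> 2 / 3 * r * M \<le> norm (f i h))" for i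
    by (rule lp_functional_norming[OF assms(1) assms(2)[of i]]) blast
  then obtain M where M: "\<And>i. 0 \<le> M i" "\<And>i x. x \<in> lp p \<Longrightarrow> norm (f i x) \<le> M i * lp_norm p x"
    and hump: "\<And>i r. 0 < r \<Longrightarrow> \<exists>h\<in>lp p. lp_norm p h \<le> r \<and> 2 / 3 * r * M i \<le> norm (f i h)"
    by metis
  show thesis
  proof (cases "\<exists>s::nat. \<forall>i. M i \<le> 4 ^ s")
    case True
    then obtain s :: nat where s: "\<And>i. M i \<le> 4 ^ s" by blast
    have "norm (f i x) \<le> 4 ^ s * lp_norm p x" if "x \<in> lp p" for i x
      using M(2)[OF that, of i] mult_right_mono[OF s[of i] lp_norm_nonneg[of p x]] by simp
    then show thesis
      using that[of "4 ^ s"] by simp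
  next
    case False
    \<comment> \<open>Norms beyond 4^s outgrow the hump radii (1/3)^s, so the values at the limit
      will grow like (4/3)^s.\<close>
    then obtain i where i: "\<And>s::nat. 4 ^ s < M (i s)"
      by (metis not_le)
    define g where "g s = f (i s)" for s
    have "\<exists>h\<in>lp p. lp_norm p h \<le> (1 / 3) ^ s \<and> 2 / 3 * (1 / 3) ^ s * M (i s) \<le> norm (g s h)" for s
      unfolding g_def by (rule hump) simp
    then obtain h where h: "\<And>s. h s \<in> lp p" "\<And>s. lp_norm p (h s) \<le> (1 / 3) ^ s"
      "\<And>s. 2 / 3 * (1 / 3) ^ s * M (i s) \<le> norm (g s (h s))"
      by metis
    define x where "x = rec_nat (\<lambda>k. 0) (\<lambda>s y.
      if norm (g s (h s)) \<le> norm (g s (\<lambda>k. y k + h s k)) then (\<lambda>k. y k + h s k) else (\<lambda>k. y k - h s k))"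
    have x0: "x 0 = (\<lambda>k. 0)"
      and xS: "\<And>s. x (Suc s) = (if norm (g s (h s)) \<le> norm (g s (\<lambda>k. x s k + h s k))
        then (\<lambda>k. x s k + h s k) else (\<lambda>k. x s k - h s k))"
      by (simp_all add: x_def)
    have x: "x s \<in> lp p" for s
      by (induction s) (auto simp: x0 xS lp_zero p assms(1) h lp_add lp_minus)
    have "lp_norm p (\<lambda>k. - h s k) = lp_norm p (h s)" for s
      using lp_norm_scale[OF p h(1)[of s], of "- 1"] by simp
    then have "lp_norm p (\<lambda>k. x (Suc s) k - x s k) \<le> (1 / 3) ^ s" for s
      using h(2)[of s] by (auto simp: xS)
    from lp_geometric_limit[OF assms(1) x this]
    obtain X where X: "X \<in> lp p" "\<And>s. lp_norm p (\<lambda>k. X k - x s k) \<le> 3 / 2 * (1 / 3) ^ s"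
      by blast
    have g: "lp_functional p (g s)" for s
      unfolding g_def by (rule assms(2))
    have big: "norm (g s (h s)) \<le> norm (g s (x (Suc s)))" for s
    proof (cases "norm (g s (h s)) \<le> norm (g s (\<lambda>k. x s k + h s k))")
      case False
      have "g s (\<lambda>k. x s k + h s k) = g s (x s) + g s (h s)"
        by (rule lp_functional_add[OF g x h(1)])
      moreover have "g s (\<lambda>k. x s k - h s k) = g s (x s) - g s (h s)"
        by (rule lp_functional_minus[OF assms(1) g x h(1)])
      moreover have "2 * norm (g s (h s))
          \<le> norm (g s (x s) + g s (h s)) + norm (g s (x s) - g s (h s))"
        using norm_triangle_ineq4[of "g s (x s) + g s (h s)" "g s (x s) - g s (h s)"]
        by (simp add: norm_mult[symmetric] flip: mult_2)
      ultimately show ?thesis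
        using False by (simp add: xS)
    qed (simp add: xS)
    \<comment> \<open>In units of (1/3)^s * M (i s), the value after step \<open>s\<close> is at
      least 2/3 and all later humps together change it by at most 1/2; this leaves 1/6.\<close>
    have grow: "(4 / 3) ^ s / 6 \<le> norm (g s X)" for s
    proof -
      have "norm (g s X - g s (x (Suc s))) \<le> M (i s) * lp_norm p (\<lambda>k. X k - x (Suc s) k)"
        using M(2)[OF lp_minus[OF assms(1) X(1) x[of "Suc s"]], of "i s"]
          lp_functional_minus[OF assms(1) g X(1) x, of s "Suc s"] by (simp add: g_def)
      also have "\<dots> \<le> M (i s) * (3 / 2 * (1 / 3) ^ Suc s)"
        by (intro mult_left_mono X M)
      finally have "norm (g s (x (Suc s))) - norm (g s X) \<le> M (i s) * (3 / 2 * (1 / 3) ^ Suc s)"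
        using norm_triangle_ineq2[of "g s (x (Suc s))" "g s X"] by (simp add: norm_minus_commute)
      then have "1 / 6 * ((1 / 3) ^ s * M (i s)) \<le> norm (g s X)"
        using big[of s] h(3)[of s] by (simp add: algebra_simps)
      moreover have "(4 / 3) ^ s \<le> (1 / 3) ^ s * M (i s)"
        using mult_left_mono[OF less_imp_le[OF i[of s]], of "(1 / 3) ^ s"]
        by (simp add: power_mult_distrib[symmetric])
      ultimately show ?thesis by simp
    qed
    obtain B where B: "\<And>j. norm (f j X) \<le> B"
      using assms(3)[OF X(1)] by (auto simp: bounded_iff)
    obtain s :: nat where "6 * B < (4 / 3) ^ s"
      using real_arch_pow[of "4 / 3" "6 * B"] by auto
    with grow[of s] B[of "i s"] show thesis
      by (simp add: g_def)
  qed
qed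

text \<open>The truncations \<open>y' N\<close> converge to \<open>y\<close> in norm, since tails
  vanish for finite \<open>p\<close>; a bounded functional is therefore determined by its values at
  the unit vectors.\<close>

lemma lp_functional_sums:
  assumes "1 \<le> p" "lp_functional p f" "y \<in> lp p"
  shows "(\<lambda>k. f (\<lambda>j. if j = k then 1 else 0) * y k) sums f y"
proof -
  have p: "0 < p" using assms by simp
  let ?e = "\<lambda>k j. if j = k then 1 else 0 :: complex"
  define y' where "y' N k = (if k < N then y k else 0)" for N k
  have y': "y' N \<in> lp p" for N
    by (rule lp_finite_support(1)[OF p, of "{..<N}"]) (auto simp: y'_def)
  have partial: "f (y' N) = (\<Sum>k<N. f (?e k) * y k)" for N
  proof (induction N)
    case 0
    have "f (\<lambda>k. 0 * (0::complex)) = 0 * f (\<lambda>k. 0)"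
      by (rule lp_functional_scale[OF assms(2) lp_zero(1)[OF p]])
    then show ?case by (simp add: y'_def)
  next
    case (Suc N)
    have eq: "y' (Suc N) = (\<lambda>k. y' N k + y N * ?e N k)"
      by (auto simp: y'_def less_Suc_eq)
    have "f (y' (Suc N)) = f (y' N) + f (\<lambda>k. y N * ?e N k)"
      unfolding eq by (intro lp_functional_add[OF assms(2)] y' lp_scale lp_unit p)
    also have "f (\<lambda>k. y N * ?e N k) = y N * f (?e N)"
      by (intro lp_functional_scale[OF assms(2)] lp_unit p)
    finally show ?case
      using Suc by simp
  qed
  obtain C where C: "\<And>x. x \<in> lp p \<Longrightarrow> norm (f x) \<le> C * lp_norm p x"
    using assms(2) unfolding lp_functional_def by blast
  have tail: "lp_norm p (\<lambda>k. y k - y' N k) = lp_norm p (\<lambda>k. y (N + k))" for N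
  proof -
    have "(\<Sum>k. norm (y k - y' N k) powr p)
        = (\<Sum>k. norm (y (k + N) - y' N (k + N)) powr p) + (\<Sum>k<N. norm (y k - y' N k) powr p)"
      using lp_minus[OF assms(1,3) y'[of N]] by (intro suminf_split_initial_segment) (simp add: lp_def)
    also have "\<dots> = (\<Sum>k. norm (y (N + k)) powr p)"
      by (simp add: y'_def add.commute)
    finally show ?thesis
      by (simp add: lp_norm_def)
  qed
  have "(\<lambda>N. C * lp_norm p (\<lambda>k. y (N + k))) \<longlonglongrightarrow> C * 0"
    by (intro tendsto_mult_left lp_tail_tendsto_0 p assms)
  then have "(\<lambda>N. f y - f (y' N)) \<longlonglongrightarrow> 0"
    unfolding mult_zero_right
  proof (rule Lim_null_comparison[rotated])
    have "norm (f y - f (y' N)) \<le> C * lp_norm p (\<lambda>k. y (N + k))" for N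
      using C[OF lp_minus[OF assms(1,3) y'[of N]]]
      by (simp add: tail lp_functional_minus[OF assms(1-3) y'])
    then show "\<forall>\<^sub>F N in sequentially. norm (f y - f (y' N)) \<le> C * lp_norm p (\<lambda>k. y (N + k))"
      by simp
  qed
  then have "(\<lambda>N. f (y' N)) \<longlonglongrightarrow> f y"
    using tendsto_diff[OF tendsto_const[of "f y"]] by fastforce
  then show ?thesis
    by (simp add: sums_def partial)
qed

section \<open>Reduction to the associated matrix\<close>

lemma frac_coeff_gbinomial:
  assumes "\<alpha> \<notin> \<int>"
  shows "frac_coeff \<alpha> i = (- 1) ^ i * (\<alpha> gchoose i)"
proof -
  have "\<alpha> + 1 \<notin> \<int>\<^sub>\<le>\<^sub>0"
    using assms Ints_diff[of "\<alpha> + 1" 1] nonpos_Ints_Int by force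
  then show ?thesis
    by (simp add: frac_coeff_def gbinomial_Gamma)
qed

text \<open>Viewing the operator as multiplication of formal power series makes associativity
  available for composing differences.\<close>

lemma frac_diff_nth: "frac_diff \<alpha> x k = fps_nth (Abs_fps (\<lambda>i. of_real (frac_coeff \<alpha> i)) * Abs_fps x) k"
  by (simp add: frac_diff_def fps_mult_nth)

text \<open>The coefficient form of (1 - z)^\<alpha> (1 - z)^(-\<alpha>) = 1, obtained from
  Vandermonde's identity for \<alpha> and -\<alpha>.\<close>

lemma frac_coeff_inverse:
  assumes "\<alpha> \<notin> \<int>"
  shows "Abs_fps (\<lambda>i. complex_of_real (frac_coeff \<alpha> i)) * Abs_fps (\<lambda>i. of_real (frac_coeff (- \<alpha>) i)) = 1"
proof (rule fps_ext)
  fix n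
  have "- \<alpha> \<notin> \<int>"
    using assms by (simp add: minus_in_Ints_iff)
  then have "(\<Sum>i=0..n. frac_coeff \<alpha> i * frac_coeff (- \<alpha>) (n - i))
      = (\<Sum>i=0..n. (- 1) ^ n * ((\<alpha> gchoose i) * (- \<alpha> gchoose (n - i))))"
    using assms by (intro sum.cong) (auto simp: frac_coeff_gbinomial power_add[symmetric])
  also have "\<dots> = (- 1) ^ n * (0 gchoose n)"
    using gbinomial_Vandermonde[of \<alpha> "- \<alpha>" n] by (simp add: sum_distrib_left[symmetric])
  also have "\<dots> = (if n = 0 then 1 else 0)"
    by (cases n) auto
  finally show "fps_nth (Abs_fps (\<lambda>i. complex_of_real (frac_coeff \<alpha> i)) * Abs_fps (\<lambda>i. of_real (frac_coeff (- \<alpha>) i))) n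
      = fps_nth 1 n"
    by (simp add: fps_mult_nth flip: of_real_mult of_real_sum)
qed

lemma frac_diff_frac_diff:
  assumes "\<alpha> \<notin> \<int>"
  shows "frac_diff \<alpha> (frac_diff (- \<alpha>) x) = x"
proof
  fix k
  have "Abs_fps (frac_diff (- \<alpha>) x) = Abs_fps (\<lambda>i. of_real (frac_coeff (- \<alpha>) i)) * Abs_fps x"
    by (rule fps_ext) (simp add: frac_diff_nth)
  then show "frac_diff \<alpha> (frac_diff (- \<alpha>) x) k = x k"
    by (simp add: frac_diff_nth[of \<alpha>] mult.assoc[symmetric] frac_coeff_inverse[OF assms])
qed

lemma frac_diff_add: "frac_diff \<alpha> (\<lambda>k. x k + y k) = (\<lambda>k. frac_diff \<alpha> x k + frac_diff \<alpha> y k)"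
  by (simp add: frac_diff_def ring_distribs sum.distrib)

lemma frac_diff_scale: "frac_diff \<alpha> (\<lambda>k. c * x k) = (\<lambda>k. c * frac_diff \<alpha> x k)"
  by (simp add: frac_diff_def sum_distrib_left mult_ac)

lemma mem_lp_diff:
  assumes "\<alpha> \<notin> \<int>"
  shows "frac_diff (- \<alpha>) y \<in> lp_diff \<alpha> p \<longleftrightarrow> y \<in> lp p"
  by (simp add: lp_diff_def frac_diff_frac_diff[OF assms])

text \<open>The inverse difference of the k-th unit vector is the coefficient sequence shifted by
  \<open>k\<close>, so row \<open>n\<close> of \<open>A\<close> applied to it is the series defining
  the entry of the associated matrix.\<close>

lemma mat_op_frac_diff_unit:
  "mat_op A (frac_diff (- \<alpha>) (\<lambda>j. if j = k then 1 else 0)) n = hat_mat \<alpha> A n k"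
proof -
  let ?e = "\<lambda>j. if j = k then 1 else 0 :: complex"
  have x: "frac_diff (- \<alpha>) ?e j = (if j < k then 0 else of_real (frac_coeff (- \<alpha>) (j - k)))" for j
  proof -
    have "frac_diff (- \<alpha>) ?e j = (\<Sum>i=0..j. if i = j - k \<and> k \<le> j then of_real (frac_coeff (- \<alpha>) i) else 0)"
      unfolding frac_diff_def by (intro sum.cong) auto
    then show ?thesis
      by (cases "k \<le> j") auto
  qed
  let ?g = "\<lambda>j. A n j * frac_diff (- \<alpha>) ?e j"
  have "(\<Sum>j<k. ?g j) = 0"
    by (intro sum.neutral) (simp add: x)
  \<comment> \<open>The equivalence for every \<open>s\<close> makes the two \<open>suminf\<close>
    values equal whether or not the series converge.\<close>
  then have "?g sums s \<longleftrightarrow> (\<lambda>i. ?g (i + k)) sums s" for s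
    using sums_iff_shift'[of ?g k s] by simp
  then have "suminf ?g = (\<Sum>i. ?g (i + k))"
    by (simp add: suminf_def)
  also have "\<dots> = hat_mat \<alpha> A n k"
    by (simp add: x hat_mat_def mult.commute add.commute)
  finally show ?thesis
    by (simp add: mat_op_def)
qed

section \<open>Transfer to a bounded matrix on \<open>l_p\<close>\<close>

text \<open>Since \<open>D\<close> preserves norms and maps \<open>X\<close> onto \<open>Z\<close>,
  bounded sequences in \<open>Z\<close> are precisely the images of bounded sequences in
  \<open>X\<close>. It will be applied to the inverse difference operator.\<close>

lemma compact_operator_reparametrise:
  assumes "D ` X = Z" "\<And>x. x \<in> X \<Longrightarrow> nZ (D x) = nX x" "\<And>x. x \<in> X \<Longrightarrow> T (D x) = S x"
  shows "compact_operator Z nZ Y nY T \<longleftrightarrow> compact_operator X nX Y nY S"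
proof -
  have img: "T ` Z = S ` X"
    using assms by (force simp: image_iff)
  show ?thesis
  proof
    assume T: "compact_operator Z nZ Y nY T"
    have "\<exists>r. \<exists>y\<in>Y. strict_mono r \<and> (\<lambda>n. nY (\<lambda>k. S (x (r n)) k - y k)) \<longlonglongrightarrow> 0"
      if bdd: "(\<forall>n. x n \<in> X) \<and> (\<exists>C. \<forall>n. nX (x n) \<le> C)" for x :: "nat \<Rightarrow> cseq"
    proof -
      obtain C where x: "\<And>n. x n \<in> X" "\<And>n. nX (x n) \<le> C"
        using bdd by blast
      have "(\<forall>n. D (x n) \<in> Z) \<and> (\<exists>C. \<forall>n. nZ (D (x n)) \<le> C)"
        using x assms by auto
      with T obtain r y where "y \<in> Y" "strict_mono r" "(\<lambda>n. nY (\<lambda>k. T (D (x (r n))) k - y k)) \<longlonglongrightarrow> 0"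
        unfolding compact_operator_def by meson
      then show ?thesis
        using assms(3) x(1) by auto
    qed
    moreover have "S ` X \<subseteq> Y"
      using T img by (simp add: compact_operator_def)
    ultimately show "compact_operator X nX Y nY S"
      unfolding compact_operator_def by (intro conjI allI impI)
  next
    assume S: "compact_operator X nX Y nY S"
    have "\<exists>r. \<exists>y\<in>Y. strict_mono r \<and> (\<lambda>n. nY (\<lambda>k. T (z (r n)) k - y k)) \<longlonglongrightarrow> 0"
      if bdd: "(\<forall>n. z n \<in> Z) \<and> (\<exists>C. \<forall>n. nZ (z n) \<le> C)" for z :: "nat \<Rightarrow> cseq"
    proof -
      obtain C where z: "\<And>n. z n \<in> Z" "\<And>n. nZ (z n) \<le> C"
        using bdd by blast
      have "\<forall>n. \<exists>x. x \<in> X \<and> z n = D x"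
        using z(1) assms(1) by blast
      then obtain x where x: "\<And>n. x n \<in> X" "\<And>n. z n = D (x n)"
        by metis
      have "nX (x n) \<le> C" for n
        using x[of n] z(2)[of n] assms(2)[of "x n"] by simp
      then have "(\<forall>n. x n \<in> X) \<and> (\<exists>C. \<forall>n. nX (x n) \<le> C)"
        using x(1) by blast
      with S obtain r y where "y \<in> Y" "strict_mono r" "(\<lambda>n. nY (\<lambda>k. S (x (r n)) k - y k)) \<longlonglongrightarrow> 0"
        unfolding compact_operator_def by meson
      then show ?thesis
        using assms(3) x by auto
    qed
    moreover have "T ` Z \<subseteq> Y"
      using S img by (simp add: compact_operator_def)
    ultimately show "compact_operator Z nZ Y nY T"
      unfolding compact_operator_def by (intro conjI allI impI)
  qed
qed

text \<open>The situation after the change of variables, with one bound \<open>C\<close> for all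
  rows. Convergence is demanded separately because \<open>mat_op\<close> has a value even for
  divergent series.\<close>

locale bounded_matrix =
  fixes p C :: real and b :: cmatrix
  assumes p: "1 \<le> p" and C: "0 \<le> C"
    and row_summable: "\<And>n y. y \<in> lp p \<Longrightarrow> summable (\<lambda>k. b n k * y k)"
    and row_bound: "\<And>n y. y \<in> lp p \<Longrightarrow> norm (mat_op b y n) \<le> C * lp_norm p y"

text \<open>Banach-Steinhaus for one row: its partial sums involve finitely many coordinates and are
  bounded functionals. They converge pointwise, so they have a common bound, which the limit
  inherits.\<close>

lemma lp_functional_mat_op:
  assumes "\<alpha> \<notin> \<int>" "1 \<le> p" "A \<in> mat_class (lp_diff \<alpha> p) Y"
  shows "lp_functional p (\<lambda>y. mat_op A (frac_diff (- \<alpha>) y) n)"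
proof -
  have p: "0 < p" using assms by simp
  have summ: "summable (\<lambda>k. A n k * frac_diff (- \<alpha>) y k)" if "y \<in> lp p" for y
    using assms(3) that mem_lp_diff[OF assms(1), of y p] unfolding mat_class_def by blast
  define g where "g K y = (\<Sum>k<K. A n k * frac_diff (- \<alpha>) y k)" for K y
  have g: "lp_functional p (g K)" for K
  proof -
    let ?C = "\<Sum>k<K. norm (A n k) * (\<Sum>i=0..k. \<bar>frac_coeff (- \<alpha>) i\<bar>)"
    have "norm (g K x) \<le> ?C * lp_norm p x" if x: "x \<in> lp p" for x
    proof -
      have "norm (frac_diff (- \<alpha>) x k) \<le> (\<Sum>i=0..k. \<bar>frac_coeff (- \<alpha>) i\<bar>) * lp_norm p x" for k
        unfolding frac_diff_def sum_distrib_right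
        by (intro sum_norm_le) (auto simp: norm_mult intro!: mult_left_mono lp_norm_coord[OF p x])
      then show ?thesis
        unfolding g_def sum_distrib_right[of _ "{..<K}"]
        by (intro sum_norm_le) (auto simp: norm_mult mult.assoc intro!: mult_left_mono)
    qed
    then have "\<exists>C. \<forall>x\<in>lp p. norm (g K x) \<le> C * lp_norm p x"
      by blast
    moreover have "g K (\<lambda>k. x k + y k) = g K x + g K y" "g K (\<lambda>k. c * x k) = c * g K x" for c x y
      by (simp_all add: g_def frac_diff_add frac_diff_scale ring_distribs sum.distrib
          sum_distrib_left mult.left_commute)
    ultimately show ?thesis
      by (simp add: lp_functional_def)
  qed
  have lim: "(\<lambda>K. g K y) \<longlonglongrightarrow> mat_op A (frac_diff (- \<alpha>) y) n" if "y \<in> lp p" for y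
    unfolding g_def mat_op_def using summ[OF that] by (rule summable_LIMSEQ)
  have bdd: "bounded (range (\<lambda>K. g K y))" if "y \<in> lp p" for y
    by (rule convergent_imp_bounded[OF lim[OF that]])
  obtain C where C: "\<And>K y. y \<in> lp p \<Longrightarrow> norm (g K y) \<le> C * lp_norm p y"
    using lp_uniform_boundedness[OF assms(2) g bdd] by metis
  have "norm (mat_op A (frac_diff (- \<alpha>) y) n) \<le> C * lp_norm p y" if "y \<in> lp p" for y
    by (rule LIMSEQ_le_const2[OF tendsto_norm[OF lim[OF that]]]) (use C[OF that] in blast)
  then have "\<exists>C. \<forall>y\<in>lp p. norm (mat_op A (frac_diff (- \<alpha>) y) n) \<le> C * lp_norm p y"
    by blast
  moreover have "mat_op A (frac_diff (- \<alpha>) (\<lambda>k. x k + y k)) n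
      = mat_op A (frac_diff (- \<alpha>) x) n + mat_op A (frac_diff (- \<alpha>) y) n"
    if "x \<in> lp p" "y \<in> lp p" for x y
    using suminf_add[OF summ[OF that(1)] summ[OF that(2)]]
    by (simp add: mat_op_def frac_diff_add ring_distribs)
  moreover have "mat_op A (frac_diff (- \<alpha>) (\<lambda>k. c * x k)) n = c * mat_op A (frac_diff (- \<alpha>) x) n"
    if "x \<in> lp p" for x c
    using suminf_mult[OF summ[OF that], of c]
    by (simp add: mat_op_def frac_diff_scale mult.left_commute)
  ultimately show ?thesis
    by (simp add: lp_functional_def)
qed

text \<open>A second use of uniform boundedness, now over the rows: they are pointwise bounded
  because \<open>A\<close> maps into \<open>linf\<close>. Expansion along unit vectors identifies
  the transformed operator with the associated matrix.\<close>

lemma mat_class_lp_diff_linf: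
  assumes "\<alpha> \<notin> \<int>" "1 \<le> p" "A \<in> mat_class (lp_diff \<alpha> p) linf"
  shows "\<exists>C. bounded_matrix p C (hat_mat \<alpha> A)"
    and "compact_operator (lp_diff \<alpha> p) (lp_diff_norm \<alpha> p) linf linf_norm (mat_op A) \<longleftrightarrow>
      compact_operator (lp p) (lp_norm p) linf linf_norm (mat_op (hat_mat \<alpha> A))"
proof -
  let ?f = "\<lambda>n y. mat_op A (frac_diff (- \<alpha>) y) n"
  have sums: "(\<lambda>k. hat_mat \<alpha> A n k * y k) sums ?f n y" if "y \<in> lp p" for n y
    using lp_functional_sums[OF assms(2) lp_functional_mat_op[OF assms] that, of n]
    by (simp add: mat_op_frac_diff_unit)
  then have eq: "mat_op A (frac_diff (- \<alpha>) y) = mat_op (hat_mat \<alpha> A) y" if "y \<in> lp p" for y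
    using that by (auto simp: mat_op_def sums_iff)
  have bdd: "bounded (range (\<lambda>n. ?f n y))" if "y \<in> lp p" for y
    using assms(3) that mem_lp_diff[OF assms(1), of y p] unfolding mat_class_def linf_def by blast
  obtain C where C: "0 \<le> C" "\<And>n y. y \<in> lp p \<Longrightarrow> norm (?f n y) \<le> C * lp_norm p y"
    using lp_uniform_boundedness[OF assms(2) lp_functional_mat_op[OF assms] bdd] by metis
  have "bounded_matrix p C (hat_mat \<alpha> A)"
    using assms(2) C sums eq by unfold_locales (auto simp: sums_iff)
  then show "\<exists>C. bounded_matrix p C (hat_mat \<alpha> A)" ..
  \<comment> \<open>Surjectivity is the inversion formula with \<open>- \<alpha>\<close> in place of
    \<open>\<alpha>\<close>.\<close>
  have "x \<in> frac_diff (- \<alpha>) ` lp p" if "x \<in> lp_diff \<alpha> p" for x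
    using that frac_diff_frac_diff[of "- \<alpha>" x] assms(1)
    by (intro image_eqI[of _ _ "frac_diff \<alpha> x"]) (auto simp: lp_diff_def minus_in_Ints_iff)
  then have "frac_diff (- \<alpha>) ` lp p = lp_diff \<alpha> p"
    using mem_lp_diff[OF assms(1)] by blast
  then show "compact_operator (lp_diff \<alpha> p) (lp_diff_norm \<alpha> p) linf linf_norm (mat_op A) \<longleftrightarrow>
      compact_operator (lp p) (lp_norm p) linf linf_norm (mat_op (hat_mat \<alpha> A))"
    using eq by (intro compact_operator_reparametrise[of "frac_diff (- \<alpha>)"])
      (auto simp: lp_diff_norm_def frac_diff_frac_diff[OF assms(1)])
qed

section \<open>Compactness of bounded matrices\<close>

lemma linf_coord: "x \<in> linf \<Longrightarrow> norm (x k) \<le> linf_norm x"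
  unfolding linf_def linf_norm_def
  by (intro cSUP_upper) (auto simp: bounded_iff bdd_above_def)

lemma linf_norm_leI: "(\<And>k. norm (x k) \<le> c) \<Longrightarrow> linf_norm x \<le> c"
  unfolding linf_norm_def by (intro cSUP_least) auto

lemma linfI: "(\<And>k. norm (x k) \<le> c) \<Longrightarrow> x \<in> linf"
  by (auto simp: linf_def bounded_iff)

lemma linf_minus:
  assumes "x \<in> linf" "y \<in> linf"
  shows "(\<lambda>k. x k - y k) \<in> linf"
proof (rule linfI[of _ "linf_norm x + linf_norm y"])
  show "norm (x k - y k) \<le> linf_norm x + linf_norm y" for k
    using norm_triangle_ineq4[of "x k" "y k"] linf_coord[OF assms(1), of k] linf_coord[OF assms(2), of k]
    by linarith
qed

lemma linf_norm_nonneg: "x \<in> linf \<Longrightarrow> 0 \<le> linf_norm x"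
  using linf_coord[of x 0] norm_ge_zero[of "x 0"] by linarith

text \<open>
  A sequence that is, up to any \<open>e\<close>, controlled by finitely many bounded coordinates \<open>\<Phi>\<close> is totally
  bounded. Tychonoff's theorem makes all these coordinates, for all \<open>e = 1/(l+1)\<close>, converge at once.
\<close>

lemma linf_convergent_subsequence:
  fixes z :: "nat \<Rightarrow> cseq"
  assumes z: "\<And>j. z j \<in> linf"
    and control: "\<And>e::real. 0 < e \<Longrightarrow> \<exists>(N::nat) K (\<Phi> :: nat \<Rightarrow> nat \<Rightarrow> complex) B.
      (\<forall>j i. norm (\<Phi> j i) \<le> B) \<and>
      (\<forall>j j' n. norm (z j n - z j' n) \<le> e + K * (\<Sum>i<N. norm (\<Phi> j i - \<Phi> j' i)))"
  obtains r :: "nat \<Rightarrow> nat" and y where "y \<in> linf" "strict_mono r"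
    "(\<lambda>j. linf_norm (\<lambda>k. z (r j) k - y k)) \<longlonglongrightarrow> 0"
proof -
  define controls where "controls l N K \<Phi> B \<longleftrightarrow> (\<forall>j i. norm (\<Phi> j i) \<le> B) \<and>
      (\<forall>j j' n. norm (z j n - z j' n) \<le> inverse (real (Suc l)) + K * (\<Sum>i<N. norm (\<Phi> j i - \<Phi> j' i)))"
    for l and N :: nat and K and \<Phi> :: "nat \<Rightarrow> nat \<Rightarrow> complex" and B
  have "\<exists>N K \<Phi> B. controls l N K \<Phi> B" for l
    unfolding controls_def by (rule control) simp
  then obtain N K \<Phi> B where "\<And>l. controls l (N l) (K l) (\<Phi> l) (B l)"
    by metis
  then have \<Phi>: "\<And>l j i. norm (\<Phi> l j i) \<le> B l" and
    diff: "\<And>l j j' n. norm (z j n - z j' n)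
      \<le> inverse (real (Suc l)) + K l * (\<Sum>i<N l. norm (\<Phi> l j i - \<Phi> l j' i))"
    unfolding controls_def by blast+
  \<comment> \<open>A product of closed discs over all pairs (l, i), so that one subsequence serves
    every precision 1/(l+1). The index set is countable, which makes the product first countable and
    compactness sequential.\<close>
  define S :: "(nat \<times> nat \<Rightarrow> complex) set" where "S = PiE UNIV (\<lambda>li. cball 0 (B (fst li)))"
  have "compact S"
    using compactin_PiE[of "\<lambda>_. euclidean" UNIV "\<lambda>li. cball (0::complex) (B (fst li))"]
    by (simp add: S_def euclidean_product_topology)
  then have "seq_compact S"
    by (rule compact_imp_seq_compact)
  moreover have "(\<lambda>(l, i). \<Phi> l j i) \<in> S" for j
    using \<Phi> by (auto simp: S_def)
  ultimately obtain w and r :: "nat \<Rightarrow> nat" where r: "strict_mono r"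
    and "((\<lambda>j (l, i). \<Phi> l j i) \<circ> r) \<longlonglongrightarrow> w"
    unfolding seq_compact_def by metis
  then have w: "(\<lambda>j. \<Phi> l (r j) i) \<longlonglongrightarrow> w (l, i)" for l i
    using continuous_on_tendsto_compose[OF continuous_on_product_coordinates[of "(l, i)"],
        of "(\<lambda>j (l, i). \<Phi> l j i) \<circ> r" w sequentially]
    by (simp add: o_def)
  have "uniformly_Cauchy_on UNIV (\<lambda>j. z (r j))"
  proof (rule uniformly_Cauchy_onI)
    fix e :: real assume "0 < e"
    then obtain l where l: "inverse (real (Suc l)) < e / 2"
      using reals_Archimedean[of "e / 2"] by auto
    \<comment> \<open>Both terms of each difference tend to the same \<open>w (l, i)\<close>, so the
      control sum tends to 0 jointly in \<open>j\<close> and \<open>j'\<close>; this is the Cauchy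
      condition.\<close>
    have "((\<lambda>(j, j'). K l * (\<Sum>i<N l. norm (\<Phi> l (r j) i - \<Phi> l (r j') i)))
        \<longlongrightarrow> K l * (\<Sum>i<N l. norm (w (l, i) - w (l, i)))) (sequentially \<times>\<^sub>F sequentially)"
      unfolding case_prod_unfold
      by (intro tendsto_mult_left tendsto_sum tendsto_norm tendsto_diff)
        (auto intro: filterlim_compose[OF w filterlim_fst] filterlim_compose[OF w filterlim_snd])
    then have "\<forall>\<^sub>F jj in sequentially \<times>\<^sub>F sequentially.
        K l * (\<Sum>i<N l. norm (\<Phi> l (r (fst jj)) i - \<Phi> l (r (snd jj)) i)) < e / 2"
      using \<open>0 < e\<close> by (auto simp: case_prod_unfold dest!: order_tendstoD(2)[where a = "e / 2"])
    then obtain M where M: "\<And>j j'. M \<le> j \<Longrightarrow> M \<le> j' \<Longrightarrow>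
        K l * (\<Sum>i<N l. norm (\<Phi> l (r j) i - \<Phi> l (r j') i)) < e / 2"
      unfolding eventually_prod_sequentially by auto
    have "dist (z (r j) n) (z (r j') n) < e" if "M \<le> j" "M \<le> j'" for j j' n
      using diff[of "r j" n "r j'" l] M[OF that] l by (simp add: dist_norm)
    then show "\<exists>M. \<forall>n\<in>UNIV. \<forall>j\<ge>M. \<forall>j'\<ge>M. dist (z (r j) n) (z (r j') n) < e"
      by blast
  qed
  then obtain y where y: "uniform_limit UNIV (\<lambda>j. z (r j)) y sequentially"
    unfolding uniformly_convergent_eq_Cauchy[symmetric] uniformly_convergent_on_def by blast
  have close: "\<exists>M. \<forall>j\<ge>M. \<forall>n. norm (z (r j) n - y n) < e" if "0 < e" for e
    using y that unfolding uniform_limit_sequentially_iff by (auto simp: dist_norm)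
  obtain j where j: "\<And>n. norm (z (r j) n - y n) < 1"
    using close[of 1] by auto
  have "norm (y n) \<le> linf_norm (z (r j)) + 1" for n
    using norm_triangle_ineq4[of "z (r j) n" "z (r j) n - y n"] linf_coord[OF z[of "r j"], of n] j[of n] by simp
  then have yl: "y \<in> linf"
    by (rule linfI)
  have "(\<lambda>j. linf_norm (\<lambda>k. z (r j) k - y k)) \<longlonglongrightarrow> 0"
  proof (rule LIMSEQ_I)
    fix e :: real assume "0 < e"
    then obtain M where M: "\<And>j n. M \<le> j \<Longrightarrow> norm (z (r j) n - y n) < e / 2"
      using close[of "e / 2"] by auto
    have "linf_norm (\<lambda>k. z (r j) k - y k) \<le> e / 2" if "M \<le> j" for j
      using M[OF that] by (intro linf_norm_leI less_imp_le)
    then show "\<exists>M. \<forall>j\<ge>M. norm (linf_norm (\<lambda>k. z (r j) k - y k) - 0) < e"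
      using linf_norm_nonneg[OF linf_minus[OF z yl]] \<open>0 < e\<close>
      by (intro exI[of _ M]) (fastforce simp: abs_of_nonneg)
  qed
  with r yl show thesis
    using that by blast
qed

section \<open>Bounded matrices from \<open>l_p\<close> to bounded sequences\<close>

context bounded_matrix
begin

lemma p_pos: "0 < p"
  using p by simp

lemma mat_op_minus:
  assumes "x \<in> lp p" "y \<in> lp p"
  shows "mat_op b (\<lambda>k. x k - y k) n = mat_op b x n - mat_op b y n"
  using suminf_diff[OF row_summable[OF assms(1)] row_summable[OF assms(2)]]
  by (simp add: mat_op_def right_diff_distrib)

lemma mat_op_unit: "mat_op b (\<lambda>j. if j = k then 1 else 0) n = b n k"
proof -
  have "(\<lambda>j. b n j * (if j = k then 1 else 0)) = (\<lambda>j. if j = k then b n j else 0)"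
    by auto
  then show ?thesis
    using sums_single[of k "b n"] by (simp add: mat_op_def sums_iff)
qed

lemma entry_bound: "norm (b n k) \<le> C"
  using row_bound[OF lp_unit(1)[OF p_pos, of k], of n] by (simp add: mat_op_unit lp_unit(2)[OF p_pos])

lemma mat_op_linf: "y \<in> lp p \<Longrightarrow> mat_op b y \<in> linf"
  by (rule linfI[OF row_bound])

text \<open>Both sufficiency proofs go through this criterion: they only have to exhibit the
  finitely many controlling coordinates \<Phi>.\<close>

lemma compact_operatorI:
  assumes "\<And>x D e. \<lbrakk>\<And>j. x j \<in> lp p; \<And>j. lp_norm p (x j) \<le> D; 0 \<le> D; (0::real) < e\<rbrakk> \<Longrightarrow>
    \<exists>(N::nat) K (\<Phi> :: nat \<Rightarrow> nat \<Rightarrow> complex) B. (\<forall>j i. norm (\<Phi> j i) \<le> B) \<and>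
      (\<forall>j j' n. norm (mat_op b (x j) n - mat_op b (x j') n) \<le> e + K * (\<Sum>i<N. norm (\<Phi> j i - \<Phi> j' i)))"
  shows "compact_operator (lp p) (lp_norm p) linf linf_norm (mat_op b)"
proof -
  have "\<exists>r. \<exists>y\<in>linf. strict_mono r \<and> (\<lambda>n. linf_norm (\<lambda>k. mat_op b (x (r n)) k - y k)) \<longlonglongrightarrow> 0"
    if bdd: "(\<forall>j. x j \<in> lp p) \<and> (\<exists>D. \<forall>j. lp_norm p (x j) \<le> D)" for x :: "nat \<Rightarrow> cseq"
  proof -
    obtain D where x: "\<And>j. x j \<in> lp p" "\<And>j. lp_norm p (x j) \<le> D"
      using bdd by blast
    have D: "0 \<le> D"
      using x(2)[of 0] lp_norm_nonneg[of p "x 0"] by linarith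
    obtain r y where "y \<in> linf" "strict_mono r"
      "(\<lambda>n. linf_norm (\<lambda>k. mat_op b (x (r n)) k - y k)) \<longlonglongrightarrow> 0"
      by (rule linf_convergent_subsequence[of "\<lambda>j. mat_op b (x j)", OF mat_op_linf[OF x(1)] assms[OF x D]])
    then show ?thesis
      by blast
  qed
  moreover have "mat_op b ` lp p \<subseteq> linf"
    using mat_op_linf by blast
  ultimately show ?thesis
    unfolding compact_operator_def by (intro conjI allI impI)
qed

text \<open>Sup-norm convergence is unfolded to convergence uniform in the row index, the form used
  by both necessity proofs.\<close>

lemma compact_operatorD:
  assumes "compact_operator (lp p) (lp_norm p) linf linf_norm (mat_op b)"
    and "\<And>j. x j \<in> lp p" "\<And>j. lp_norm p (x j) \<le> D"
  shows "\<exists>(r :: nat \<Rightarrow> nat) w. strict_mono r \<and> w \<in> linf \<and>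
    (\<forall>e>0. \<exists>J. \<forall>j\<ge>J. \<forall>n. norm (mat_op b (x (r j)) n - w n) < e)"
proof -
  obtain r w where r: "w \<in> linf" "strict_mono r"
    and lim: "(\<lambda>j. linf_norm (\<lambda>k. mat_op b (x (r j)) k - w k)) \<longlonglongrightarrow> 0"
    using assms(1)[unfolded compact_operator_def, THEN conjunct2, rule_format, of x] assms(2,3) by blast
  have "\<exists>J. \<forall>j\<ge>J. \<forall>n. norm (mat_op b (x (r j)) n - w n) < e" if e: "0 < e" for e
  proof -
    obtain J where J: "\<And>j. J \<le> j \<Longrightarrow> linf_norm (\<lambda>k. mat_op b (x (r j)) k - w k) < e"
      using order_tendstoD(2)[OF lim e] unfolding eventually_sequentially by blast
    have "norm (mat_op b (x (r j)) n - w n) < e" if "J \<le> j" for j n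
      using linf_coord[OF linf_minus[OF mat_op_linf[OF assms(2)] r(1)], of "r j" n] J[OF that] by simp
    then show ?thesis by blast
  qed
  with r show ?thesis
    by blast
qed

lemma column_difference_bound: "norm (b n k1 - b n k2) \<le> 2 * C"
  using norm_triangle_ineq4[of "b n k1" "b n k2"] entry_bound[of n k1] entry_bound[of n k2] by linarith

section \<open>Row tails and compactness for p > 1\<close>

context
  fixes q :: real
  assumes p_gt_1: "1 < p" and q: "q = p / (p - 1)"
begin

lemma q_pos: "0 < q"
  by (rule conjugate_exponent(2)[OF p_gt_1 q])

text \<open>On finitely supported sequences the row bound is exactly the hypothesis of the converse
  of Hoelder's inequality.\<close>

lemma row_in_lq: "b n \<in> lp q" "lp_norm q (b n) \<le> C"
proof -
  have bound: "norm (\<Sum>k<N. b n k * y k) \<le> C * lp_norm p y" if y: "\<And>k. N \<le> k \<Longrightarrow> y k = 0" for N y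
  proof -
    have "mat_op b y n = (\<Sum>k<N. b n k * y k)"
      unfolding mat_op_def using y by (intro suminf_finite) auto
    then show ?thesis
      using row_bound[OF lp_finite_support(1)[OF p_pos, of "{..<N}" y], of n] y by simp
  qed
  show "b n \<in> lp q" "lp_norm q (b n) \<le> C"
    using lp_dual_norm_leI[OF p_gt_1 q C, of "b n"] bound by blast+
qed

lemma row_tail: "(\<lambda>k. b n (r + k)) \<in> lp q" "lp_norm q (\<lambda>k. b n (r + k)) \<le> C"
  using lp_shift[OF q_pos row_in_lq(1), where N = r] row_in_lq(2) by (auto intro: order_trans)

lemma row_tail_bdd: "bdd_above (range (\<lambda>n. lp_norm q (\<lambda>k. b n (r + k))))"
  using row_tail(2) by (auto simp: bdd_above_def)

text \<open>The first \<open>r\<close> coordinates are estimated by the entry bound, the rest by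
  Hoelder's inequality. With small tails the first term controls the image; for \<open>y\<close>
  vanishing before \<open>r\<close> only the second remains.\<close>

lemma mat_op_split:
  assumes "y \<in> lp p"
  shows "norm (mat_op b y n) \<le> C * (\<Sum>k<r. norm (y k)) + lp_norm q (\<lambda>k. b n (r + k)) * lp_norm p (\<lambda>k. y (r + k))"
proof -
  have "mat_op b y n = (\<Sum>k. b n (r + k) * y (r + k)) + (\<Sum>k<r. b n k * y k)"
    unfolding mat_op_def using suminf_split_initial_segment[OF row_summable[OF assms, of n], of r]
    by (simp add: add.commute)
  moreover have "norm (\<Sum>k<r. b n k * y k) \<le> C * (\<Sum>k<r. norm (y k))"
    unfolding sum_distrib_left
    by (intro sum_norm_le) (auto simp: norm_mult intro!: mult_right_mono entry_bound)
  moreover have "norm (\<Sum>k. b n (r + k) * y (r + k))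
      \<le> lp_norm q (\<lambda>k. b n (r + k)) * lp_norm p (\<lambda>k. y (r + k))"
    by (rule lp_Hoelder(2)[OF p_gt_1 q row_tail(1) lp_shift(1)[OF p_pos assms]])
  ultimately show ?thesis
    using norm_triangle_ineq[of "\<Sum>k. b n (r + k) * y (r + k)" "\<Sum>k<r. b n k * y k"] by simp
qed

text \<open>
  If the tails of the rows are not uniformly small, unit vectors supported further and further
  out are mapped to vectors of norm at least \<open>e\<close> that tend to \<open>0\<close> coordinatewise.
\<close>

lemma compact_imp_tails_uniformly_small:
  assumes "compact_operator (lp p) (lp_norm p) linf linf_norm (mat_op b)" "0 < e"
  shows "\<exists>R. \<forall>r\<ge>R. \<forall>n. lp_norm q (\<lambda>k. b n (r + k)) \<le> e"
proof (rule ccontr)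
  assume neg: "\<not> ?thesis"
  have "\<exists>y n. y \<in> lp p \<and> lp_norm p y \<le> 1 \<and> (\<forall>k<R. y k = 0) \<and> e < norm (mat_op b y n)" for R
  proof -
    obtain r n where r: "R \<le> r" and "\<not> lp_norm q (\<lambda>k. b n (r + k)) \<le> e"
      using neg by blast
    \<comment> \<open>If every finitely supported test vector obeyed the bound with constant
      \<open>e\<close>, the converse of Hoelder's inequality would make this tail at most
      \<open>e\<close>.\<close>
    then have "\<not> (\<forall>N y. (\<forall>k\<ge>N. y k = 0) \<longrightarrow> norm (\<Sum>k<N. b n (r + k) * y k) \<le> e * lp_norm p y)"
      using lp_dual_norm_leI(2)[OF p_gt_1 q less_imp_le[OF assms(2)], of "\<lambda>k. b n (r + k)"] by blast
    then obtain N u where u: "\<And>k. N \<le> k \<Longrightarrow> u k = 0"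
      and big: "e * lp_norm p u < norm (\<Sum>k<N. b n (r + k) * u k)"
      by (auto simp: not_le)
    have ul: "u \<in> lp p"
      by (rule lp_finite_support(1)[OF p_pos, of "{..<N}"]) (auto simp: u)
    have "lp_norm p u \<noteq> 0"
    proof
      assume "lp_norm p u = 0"
      then have "u k = 0" for k
        using lp_norm_coord[OF p_pos ul, of k] by simp
      then show False
        using big by (simp add: \<open>lp_norm p u = 0\<close>)
    qed
    then have pos: "0 < lp_norm p u"
      by (simp add: less_le)
    define c where "c = complex_of_real (1 / lp_norm p u)"
    \<comment> \<open>The test vector is moved \<open>r\<close> places to the right and normalised,
      so it vanishes before \<open>R\<close> and meets exactly the tail of row
      \<open>n\<close>.\<close>
    define y where "y k = (if k < r then 0 else c * u (k - r))" for k
    have y0: "y k = 0" if "k \<notin> {r..<r + N}" for k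
      using that by (auto simp: y_def u)
    have yl: "y \<in> lp p"
      by (rule lp_finite_support(1)[OF p_pos finite_atLeastLessThan y0])
    have reindex: "sum f {r..<r + N} = (\<Sum>k<N. f (r + k))" for f :: "nat \<Rightarrow> 'z::comm_monoid_add"
      using sum.shift_bounds_nat_ivl[of f 0 r N] by (simp add: atLeast0LessThan add.commute)
    have "lp_norm p y = (\<Sum>k\<in>{r..<r + N}. norm (y k) powr p) powr (1 / p)"
      by (rule lp_finite_support(2)[OF p_pos finite_atLeastLessThan y0])
    also have "\<dots> = (\<Sum>k<N. norm (c * u k) powr p) powr (1 / p)"
      by (simp add: reindex y_def)
    also have "\<dots> = lp_norm p (\<lambda>k. c * u k)"
      using lp_finite_support(2)[OF p_pos, of "{..<N}" "\<lambda>k. c * u k"] u by simp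
    also have "\<dots> = 1"
      using lp_norm_scale[OF p_pos ul, of c] pos by (simp add: c_def norm_divide)
    finally have "lp_norm p y = 1" .
    moreover have "mat_op b y n = (\<Sum>k\<in>{r..<r + N}. b n k * y k)"
      unfolding mat_op_def by (intro suminf_finite) (auto simp: y0)
    then have "mat_op b y n = c * (\<Sum>k<N. b n (r + k) * u k)"
      by (simp add: reindex y_def sum_distrib_left mult.left_commute)
    then have "norm (mat_op b y n) = norm (\<Sum>k<N. b n (r + k) * u k) / lp_norm p u"
      using pos by (simp add: c_def norm_mult norm_divide)
    then have "e < norm (mat_op b y n)"
      using big pos by (simp add: pos_less_divide_eq)
    ultimately show ?thesis
      using yl r by (intro exI[of _ y] exI[of _ n]) (auto simp: y_def)
  qed
  then obtain y \<nu> where y: "\<And>R. y R \<in> lp p" "\<And>R. lp_norm p (y R) \<le> 1" "\<And>R k. k < R \<Longrightarrow> y R k = 0"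
    and big: "\<And>R. e < norm (mat_op b (y R) (\<nu> R))"
    by metis
  obtain s :: "nat \<Rightarrow> nat" and w where s: "strict_mono s"
    and close: "\<forall>e>0. \<exists>J. \<forall>j\<ge>J. \<forall>n. norm (mat_op b (y (s j)) n - w n) < e"
    using compact_operatorD[of y 1, OF assms(1) y(1,2)] by (elim exE conjE)
  have "w n = 0" for n
  proof -
    \<comment> \<open>For a fixed row, splitting at \<open>R\<close> leaves only that row's own
      tail, which vanishes as \<open>R\<close> grows because the row lies in
      \<open>lp q\<close>.\<close>
    have le: "norm (mat_op b (y R) n) \<le> lp_norm q (\<lambda>k. b n (R + k))" for R
    proof -
      have "(\<Sum>k<R. norm (y R k)) = 0"
        by (simp add: y(3))
      moreover have "lp_norm p (\<lambda>k. y R (R + k)) \<le> 1"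
        using lp_shift(2)[OF p_pos y(1), of R R] y(2)[of R] by simp
      then have "lp_norm q (\<lambda>k. b n (R + k)) * lp_norm p (\<lambda>k. y R (R + k)) \<le> lp_norm q (\<lambda>k. b n (R + k))"
        by (intro mult_left_le) auto
      ultimately show ?thesis
        using mat_op_split[OF y(1), of R n R] by simp
    qed
    have "(\<lambda>R. mat_op b (y R) n) \<longlonglongrightarrow> 0"
      by (rule Lim_null_comparison[OF always_eventually[OF allI[OF le]] lp_tail_tendsto_0[OF q_pos row_in_lq(1)]])
    from LIMSEQ_subseq_LIMSEQ[OF this s]
    have "(\<lambda>j. mat_op b (y (s j)) n) \<longlonglongrightarrow> 0"
      by (simp add: o_def)
    moreover have "(\<lambda>j. mat_op b (y (s j)) n) \<longlonglongrightarrow> w n"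
    proof (rule LIMSEQ_I)
      fix d :: real assume "0 < d"
      from close[rule_format, OF this]
      show "\<exists>J. \<forall>j\<ge>J. norm (mat_op b (y (s j)) n - w n) < d"
        by blast
    qed
    ultimately show ?thesis
      using LIMSEQ_unique by blast
  qed
  \<comment> \<open>Uniform closeness to the zero sequence applies in particular to the row \<nu> (s
    J), where the image exceeds \<open>e\<close>.\<close>
  moreover obtain J where "norm (mat_op b (y (s J)) (\<nu> (s J)) - w (\<nu> (s J))) < e"
    using close[rule_format, OF assms(2)] by blast
  ultimately show False
    using big[of "s J"] by simp
qed

text \<open>The first \<open>r\<close> coordinates of the given sequences serve as \<Phi>.\<close>

lemma compact_if_tails_uniformly_small:
  assumes tails: "\<And>e. 0 < e \<Longrightarrow> \<exists>r. \<forall>n. lp_norm q (\<lambda>k. b n (r + k)) \<le> e"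
  shows "compact_operator (lp p) (lp_norm p) linf linf_norm (mat_op b)"
proof (rule compact_operatorI)
  fix x :: "nat \<Rightarrow> cseq" and D e :: real
  assume x: "\<And>j. x j \<in> lp p" "\<And>j. lp_norm p (x j) \<le> D" and D: "0 \<le> D" and "0 < e"
  \<comment> \<open>Differences of two members have norm at most \<open>2 * D\<close>; the added 1
    keeps the denominator positive when \<open>D = 0\<close>.\<close>
  then obtain r where r: "\<And>n. lp_norm q (\<lambda>k. b n (r + k)) \<le> e / (2 * D + 1)"
    using tails[of "e / (2 * D + 1)"] by auto
  have "norm (mat_op b (x j) n - mat_op b (x j') n) \<le> e + C * (\<Sum>i<r. norm (x j i - x j' i))" for j j' n
  proof -
    let ?d = "\<lambda>k. x j k - x j' k"
    have d: "?d \<in> lp p"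
      by (intro lp_minus p x)
    have "lp_norm p (\<lambda>k. ?d (r + k)) \<le> 2 * D"
      using lp_shift(2)[OF p_pos d, of r] lp_norm_minus_le[OF p x(1) x(1), of j j'] x(2)[of j] x(2)[of j']
      by linarith
    then have "lp_norm q (\<lambda>k. b n (r + k)) * lp_norm p (\<lambda>k. ?d (r + k)) \<le> e / (2 * D + 1) * (2 * D)"
      using \<open>0 < e\<close> D by (intro mult_mono r) auto
    also have "\<dots> \<le> e"
      using \<open>0 < e\<close> D by (simp add: field_simps)
    finally show ?thesis
      using mat_op_split[OF d, of n r] by (simp add: mat_op_minus[OF x(1) x(1)])
  qed
  moreover have "norm (x j i) \<le> D" for j i
    using lp_norm_coord[OF p_pos x(1), of j i] x(2)[of j] by linarith
  ultimately show "\<exists>(N::nat) K (\<Phi> :: nat \<Rightarrow> nat \<Rightarrow> complex) B. (\<forall>j i. norm (\<Phi> j i) \<le> B) \<and>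
      (\<forall>j j' n. norm (mat_op b (x j) n - mat_op b (x j') n) \<le> e + K * (\<Sum>i<N. norm (\<Phi> j i - \<Phi> j' i)))"
    by (intro exI[of _ r] exI[of _ C] exI[of _ x] exI[of _ D]) blast
qed

text \<open>The supremum dominates each row tail because the tails are bounded by \<open>C\<close>.
  The offset 1 reflects sums that start at k = r + 1.\<close>

lemma compact_iff_tails:
  "compact_operator (lp p) (lp_norm p) linf linf_norm (mat_op b) \<longleftrightarrow>
     (\<lambda>r. SUP n. lp_norm q (\<lambda>k. b n (r + 1 + k))) \<longlonglongrightarrow> 0" (is "?K \<longleftrightarrow> ?L")
proof
  have upper: "lp_norm q (\<lambda>k. b n (r + k)) \<le> (SUP n. lp_norm q (\<lambda>k. b n (r + k)))" for n r
    by (rule cSUP_upper[OF UNIV_I row_tail_bdd])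
  have nonneg: "0 \<le> (SUP n. lp_norm q (\<lambda>k. b n (r + k)))" for r
    using upper[of 0 r] order_trans[OF lp_norm_nonneg] by blast
  {
    assume K: ?K
    show ?L
    proof (rule LIMSEQ_I)
      fix e :: real assume "0 < e"
      then obtain R where R: "\<And>r n. R \<le> r \<Longrightarrow> lp_norm q (\<lambda>k. b n (r + k)) \<le> e / 2"
        using compact_imp_tails_uniformly_small[OF K, of "e / 2"] by auto
      have "(SUP n. lp_norm q (\<lambda>k. b n (r + 1 + k))) \<le> e / 2" if "R \<le> r" for r
        using that by (intro cSUP_least R) auto
      then have "norm ((SUP n. lp_norm q (\<lambda>k. b n (r + 1 + k))) - 0) < e" if "R \<le> r" for r
        using that nonneg[of "r + 1"] \<open>0 < e\<close> by fastforce
      then show "\<exists>R. \<forall>r\<ge>R. norm ((SUP n. lp_norm q (\<lambda>k. b n (r + 1 + k))) - 0) < e"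
        by blast
    qed
  }
  {
    assume L: ?L
    show ?K
    proof (rule compact_if_tails_uniformly_small)
      fix e :: real assume "0 < e"
      then obtain r where "(SUP n. lp_norm q (\<lambda>k. b n (r + 1 + k))) < e"
        using order_tendstoD(2)[OF L] unfolding eventually_sequentially by blast
      then show "\<exists>r. \<forall>n. lp_norm q (\<lambda>k. b n (r + k)) \<le> e"
        using upper[of _ "r + 1"] by (meson less_imp_le order_trans)
    qed
  }
qed

end

end

section \<open>Column distances and compactness for p = 1\<close>

text \<open>
  Rounding the first \<open>m + 1\<close> coordinates to multiples of \<open>\<eta>\<close> leaves finitely many classes;
  \<open>\<phi>\<close> picks a representative of each.
\<close>

lemma finite_net:
  fixes v :: "nat \<Rightarrow> nat \<Rightarrow> complex"
  assumes "0 < \<eta>" "\<And>n k. norm (v n k) \<le> C"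
  obtains \<phi> :: "nat \<Rightarrow> nat" where "finite (range \<phi>)" "\<And>k n. n \<le> m \<Longrightarrow> norm (v n k - v n (\<phi> k)) \<le> 2 * \<eta>"
proof -
  define Q where "Q k = (\<lambda>n\<in>{..m}. (\<lfloor>Re (v n k) / \<eta>\<rfloor>, \<lfloor>Im (v n k) / \<eta>\<rfloor>))" for k
  define L where "L = \<lceil>C / \<eta>\<rceil>"
  have floor_mem: "\<lfloor>t / \<eta>\<rfloor> \<in> {- L..L}" if "\<bar>t\<bar> \<le> C" for t
  proof -
    have "\<bar>t / \<eta>\<bar> \<le> C / \<eta>"
      using that assms(1) by (simp add: divide_right_mono)
    also have "\<dots> \<le> of_int L"
      by (simp add: L_def)
    finally have "- real_of_int L \<le> t / \<eta>" "t / \<eta> \<le> real_of_int L"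
      by linarith+
    then show ?thesis
      by (auto simp: le_floor_iff floor_le_iff)
  qed
  have "Q k \<in> PiE {..m} (\<lambda>_. {- L..L} \<times> {- L..L})" for k
    unfolding Q_def
    by (intro restrict_PiE_iff[THEN iffD2] ballI SigmaI floor_mem
        order_trans[OF abs_Re_le_cmod assms(2)] order_trans[OF abs_Im_le_cmod assms(2)])
  then have fin: "finite (range Q)"
    by (intro finite_subset[of "range Q" "PiE {..m} (\<lambda>_. {- L..L} \<times> {- L..L})"] finite_PiE) auto
  \<comment> \<open>\<open>inv Q\<close> picks the same index for all columns with equal rounding,
    so \<phi> takes at most as many values as \<open>Q\<close>.\<close>
  define \<phi> where "\<phi> k = inv Q (Q k)" for k
  have "Q (\<phi> k) = Q k" for k
    by (simp add: \<phi>_def f_inv_into_f)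
  then have same: "\<lfloor>Re (v n k) / \<eta>\<rfloor> = \<lfloor>Re (v n (\<phi> k)) / \<eta>\<rfloor>" "\<lfloor>Im (v n k) / \<eta>\<rfloor> = \<lfloor>Im (v n (\<phi> k)) / \<eta>\<rfloor>"
    if "n \<le> m" for n k
    using that unfolding Q_def by (metis (no_types, lifting) atMost_iff restrict_apply' prod.inject)+
  \<comment> \<open>Applied to real and imaginary parts separately, this gives the bound
    \<open>2 * \<eta>\<close>.\<close>
  have close: "\<bar>s - t\<bar> \<le> \<eta>" if "\<lfloor>s / \<eta>\<rfloor> = \<lfloor>t / \<eta>\<rfloor>" for s t
  proof -
    have "\<bar>s / \<eta> - t / \<eta>\<bar> \<le> 1"
      using that by linarith
    then show ?thesis
      using assms(1) by (simp add: diff_divide_distrib[symmetric])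
  qed
  have "norm (v n k - v n (\<phi> k)) \<le> 2 * \<eta>" if "n \<le> m" for n k
    using cmod_le[of "v n k - v n (\<phi> k)"] close[OF same(1)[OF that, of k]] close[OF same(2)[OF that, of k]]
    by simp
  moreover have "range \<phi> = inv Q ` range Q"
    by (auto simp: \<phi>_def)
  then have "finite (range \<phi>)"
    using fin by simp
  ultimately show thesis
    using that by blast
qed

text \<open>For \<open>UNIV\<close> and bounded columns this is their sup-norm distance; for
  \<open>{0..m}\<close> it is the part of it that the first m + 1 rows detect.\<close>

definition column_gap :: "cmatrix \<Rightarrow> nat set \<Rightarrow> nat \<Rightarrow> nat \<Rightarrow> real" where
  "column_gap b I k1 k2 = (SUP n\<in>I. norm (b n k1 - b n k2))"

context bounded_matrix
begin

lemma column_gap_upper: "n \<in> I \<Longrightarrow> norm (b n k1 - b n k2) \<le> column_gap b I k1 k2"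
  unfolding column_gap_def using column_difference_bound
  by (intro cSUP_upper) (auto simp: bdd_above_def)

lemma column_gap_mono: "I \<noteq> {} \<Longrightarrow> I \<subseteq> J \<Longrightarrow> column_gap b I k1 k2 \<le> column_gap b J k1 k2"
  unfolding column_gap_def[of b I] by (intro cSUP_least column_gap_upper) auto

text \<open>The gaps increase with \<open>m\<close> and stay below the gap over all rows.
  Convergence is therefore one-sided, and one good \<open>m\<close> for each \<open>e\<close> is
  good for all larger ones.\<close>

lemma uniform_limit_column_gap:
  "uniform_limit UNIV (\<lambda>m (k1, k2). column_gap b {0..m} k1 k2) (\<lambda>(k1, k2). column_gap b UNIV k1 k2) sequentially
    \<longleftrightarrow> (\<forall>e>0. \<exists>m. \<forall>k1 k2. column_gap b UNIV k1 k2 < column_gap b {0..m} k1 k2 + e)" (is "?L \<longleftrightarrow> ?R")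
proof -
  have dist: "dist (column_gap b {0..m} k1 k2) (column_gap b UNIV k1 k2) < e
      \<longleftrightarrow> column_gap b UNIV k1 k2 < column_gap b {0..m} k1 k2 + e" for m k1 k2 e
    using column_gap_mono[of "{0..m}" UNIV k1 k2] by (auto simp: dist_real_def)
  have mono: "column_gap b {0..m} k1 k2 \<le> column_gap b {0..m'} k1 k2" if "m \<le> m'" for m m' k1 k2
    using that by (intro column_gap_mono) auto
  have "?L \<longleftrightarrow> (\<forall>e>0. \<exists>M. \<forall>m\<ge>M. \<forall>k1 k2. column_gap b UNIV k1 k2 < column_gap b {0..m} k1 k2 + e)"
    unfolding uniform_limit_sequentially_iff by (auto simp: dist)
  also have "\<dots> \<longleftrightarrow> ?R"
    using mono by (meson add_right_mono less_le_trans order_refl)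
  finally show ?thesis .
qed

text \<open>Column differences are images of differences of two unit vectors, which have norm at
  most 2. A uniform limit \<open>w\<close> of badly detected differences nearly attains its norm in
  a single row, and that row is eventually among those inspected.\<close>

lemma compact_imp_column_gap:
  assumes K: "compact_operator (lp p) (lp_norm p) linf linf_norm (mat_op b)" and "0 < e"
  shows "\<exists>m. \<forall>k1 k2. column_gap b UNIV k1 k2 < column_gap b {0..m} k1 k2 + e"
proof (rule ccontr)
  assume "\<not> ?thesis"
  then have "\<forall>m. \<exists>k1 k2. column_gap b {0..m} k1 k2 + e \<le> column_gap b UNIV k1 k2"
    by (auto simp: not_less)
  then obtain k1 k2 where gap: "\<And>m. column_gap b {0..m} (k1 m) (k2 m) + e \<le> column_gap b UNIV (k1 m) (k2 m)"
    by metis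
  define x :: "nat \<Rightarrow> cseq" where
    "x m = (\<lambda>j. (if j = k1 m then 1 else 0) - (if j = k2 m then 1 else 0))" for m
  have x: "x m \<in> lp p" for m
    unfolding x_def by (intro lp_minus p lp_unit p_pos)
  have x2: "lp_norm p (x m) \<le> 2" for m
    using lp_norm_minus_le[OF p lp_unit(1)[OF p_pos, of "k1 m"] lp_unit(1)[OF p_pos, of "k2 m"]]
    by (simp add: x_def lp_unit(2)[OF p_pos])
  obtain r :: "nat \<Rightarrow> nat" and w where r: "strict_mono r" and w: "w \<in> linf"
    and close: "\<forall>e>0. \<exists>J. \<forall>j\<ge>J. \<forall>n. norm (mat_op b (x (r j)) n - w n) < e"
    using compact_operatorD[of x 2, OF K x x2] by (elim exE conjE)
  have Tx: "mat_op b (x m) n = b n (k1 m) - b n (k2 m)" for m n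
    unfolding x_def by (subst mat_op_minus) (auto simp: lp_unit(1)[OF p_pos] mat_op_unit)
  \<comment> \<open>Three errors of \<open>e / 4\<close> will occur: two passages between
    \<open>w\<close> and the image, and one for the nearly attained norm. Their sum stays below
    \<open>e\<close>.\<close>
  obtain J where J: "\<And>j n. J \<le> j \<Longrightarrow> norm (mat_op b (x (r j)) n - w n) < e / 4"
    using close[rule_format, of "e / 4"] \<open>0 < e\<close> by auto
  have "\<exists>n0. linf_norm w - e / 4 < norm (w n0)"
  proof (rule ccontr)
    assume "\<not> ?thesis"
    then have "linf_norm w \<le> linf_norm w - e / 4"
      by (intro linf_norm_leI) (auto simp: not_less)
    then show False using \<open>0 < e\<close> by simp
  qed
  then obtain n0 where n0: "linf_norm w - e / 4 < norm (w n0)"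
    by blast
  \<comment> \<open>As \<open>r j\<close> is at least \<open>j\<close>, row \<open>n0\<close> lies
    among the first \<open>r j + 1\<close> rows.\<close>
  define j where "j = max J n0"
  have "n0 \<le> r j"
    using seq_suble[OF r, of j] by (simp add: j_def)
  then have "norm (mat_op b (x (r j)) n0) \<le> column_gap b {0..r j} (k1 (r j)) (k2 (r j))"
    unfolding Tx by (intro column_gap_upper) auto
  moreover have "norm (w n0) \<le> norm (mat_op b (x (r j)) n0) + e / 4"
    using J[of j n0] norm_triangle_ineq3[of "mat_op b (x (r j)) n0" "w n0"] by (simp add: j_def)
  moreover have "column_gap b UNIV (k1 (r j)) (k2 (r j)) \<le> linf_norm w + e / 4"
    unfolding column_gap_def
  proof (rule cSUP_least)
    show "norm (b n (k1 (r j)) - b n (k2 (r j))) \<le> linf_norm w + e / 4" for n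
      using J[of j n] norm_triangle_ineq3[of "mat_op b (x (r j)) n" "w n"] linf_coord[OF w, of n]
      by (simp add: j_def Tx)
  qed simp
  ultimately show False
    using gap[of "r j"] n0 \<open>0 < e\<close> by linarith
qed

text \<open>
  If \<open>\<phi>\<close> moves no column by more than \<open>3 \<delta>\<close> and has finite range, then the matrix with columns
  \<open>b n (\<phi> k)\<close> has finite rank and approximates \<open>b\<close>.
\<close>

lemma compact_if_column_gap:
  assumes p1: "p = 1"
    and gap: "\<And>e. 0 < e \<Longrightarrow> \<exists>m. \<forall>k1 k2. column_gap b UNIV k1 k2 < column_gap b {0..m} k1 k2 + e"
  shows "compact_operator (lp p) (lp_norm p) linf linf_norm (mat_op b)"
proof (rule compact_operatorI)
  fix x :: "nat \<Rightarrow> cseq" and D e :: real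
  assume x: "\<And>j. x j \<in> lp p" "\<And>j. lp_norm p (x j) \<le> D" and D: "0 \<le> D" and e: "0 < e"
  \<comment> \<open>Moving columns by \<open>3 * \<delta>\<close> changes the image of a vector of
    norm at most \<open>2 * D\<close> by at most \<open>e\<close>.\<close>
  define \<delta> where "\<delta> = e / (3 * (2 * D + 1))"
  have \<delta>: "0 < \<delta>" "3 * \<delta> * (2 * D) \<le> e"
    using D e by (auto simp: \<delta>_def field_simps)
  obtain m where m: "\<And>k1 k2. column_gap b UNIV k1 k2 < column_gap b {0..m} k1 k2 + \<delta>"
    using gap[OF \<delta>(1)] by blast
  obtain \<phi> :: "nat \<Rightarrow> nat" where fin: "finite (range \<phi>)"
    and \<phi>: "\<And>k n. n \<le> m \<Longrightarrow> norm (b n k - b n (\<phi> k)) \<le> 2 * \<delta>"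
    using finite_net[of \<delta> b C m] \<delta>(1) entry_bound by blast
  \<comment> \<open>Closeness \<open>2 * \<delta>\<close> in the first m + 1 rows extends to all
    rows at the cost of one more \<delta>, by the gap condition.\<close>
  have near: "norm (b n k - b n (\<phi> k)) \<le> 3 * \<delta>" for n k
  proof -
    have "column_gap b {0..m} k (\<phi> k) \<le> 2 * \<delta>"
      unfolding column_gap_def by (intro cSUP_least \<phi>) auto
    then show ?thesis
      using column_gap_upper[of n UNIV k "\<phi> k"] m[of k "\<phi> k"] by simp
  qed
  obtain N where N: "\<And>k. \<phi> k < N"
    using finite_nat_set_iff_bounded[THEN iffD1, OF fin] by blast
  \<comment> \<open>The total mass that \<open>x j\<close> puts on the columns represented by
    \<open>i\<close>. The matrix with columns \<open>b n (\<phi> k)\<close> depends on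
    \<open>x j\<close> only through these sums.\<close>
  define \<Phi> where "\<Phi> j i = (\<Sum>k. if \<phi> k = i then x j k else 0)" for j i
  have part: "summable (\<lambda>k. norm (if \<phi> k = i then y k else 0))" if "y \<in> lp p" for y i
    using that unfolding p1 lp_1 by (rule summable_comparison_test') auto
  have "norm (\<Phi> j i) \<le> D" for j i
  proof -
    have "norm (\<Phi> j i) \<le> (\<Sum>k. norm (if \<phi> k = i then x j k else 0))"
      unfolding \<Phi>_def by (rule summable_norm[OF part[OF x(1)]])
    also have "\<dots> \<le> (\<Sum>k. norm (x j k))"
      using x(1)[of j] by (intro suminf_le part x) (auto simp: p1 lp_1)
    finally show ?thesis
      using x(1)[of j] x(2)[of j] by (simp add: p1 lp_1 lp_norm_1)
  qed
  moreover have "norm (mat_op b (x j) n - mat_op b (x j') n) \<le> e + C * (\<Sum>i<N. norm (\<Phi> j i - \<Phi> j' i))" for j j' n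
  proof -
    define d where "d k = x j k - x j' k" for k
    have d: "d \<in> lp p"
      unfolding d_def by (intro lp_minus p x)
    then have sd: "summable (\<lambda>k. norm (d k))"
      by (simp add: p1 lp_1)
    have "lp_norm p d \<le> 2 * D"
      using lp_norm_minus_le[OF p x(1) x(1), of j j'] x(2)[of j] x(2)[of j']
      unfolding d_def by linarith
    then have d2: "(\<Sum>k. norm (d k)) \<le> 2 * D"
      by (simp add: p1 lp_norm_1[OF sd])
    have le: "norm ((b n k - b n (\<phi> k)) * d k) \<le> 3 * \<delta> * norm (d k)" for k
      by (auto simp: norm_mult intro!: mult_right_mono near)
    have s1: "summable (\<lambda>k. norm ((b n k - b n (\<phi> k)) * d k))"
      by (rule summable_comparison_test'[OF summable_mult[OF sd, of "3 * \<delta>"]]) (use le in auto)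
    have "norm (\<Sum>k. (b n k - b n (\<phi> k)) * d k) \<le> (\<Sum>k. 3 * \<delta> * norm (d k))"
      using suminf_le[OF le s1 summable_mult[OF sd]] summable_norm[OF s1] by linarith
    also have "\<dots> = 3 * \<delta> * (\<Sum>k. norm (d k))"
      by (rule suminf_mult[OF sd])
    also have "\<dots> \<le> 3 * \<delta> * (2 * D)"
      using d2 \<delta>(1) by (intro mult_left_mono) auto
    also have "\<dots> \<le> e"
      by (rule \<delta>(2))
    finally have first: "norm (\<Sum>k. (b n k - b n (\<phi> k)) * d k) \<le> e" .
    have pd: "summable (\<lambda>k. if \<phi> k = i then d k else 0)" for i
      by (rule summable_norm_cancel[OF part[OF d]])
    \<comment> \<open>Splitting each term according to the value \<open>i\<close> of \<phi> turns
      the series into \<open>N\<close> series that are summed separately.\<close>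
    have rearrange: "b n (\<phi> k) * d k = (\<Sum>i<N. b n i * (if \<phi> k = i then d k else 0))" for k
      using N[of k] by (simp add: if_distrib[of "(*) _"] sum.delta cong: if_cong)
    have s2: "summable (\<lambda>k. b n (\<phi> k) * d k)"
      unfolding rearrange by (intro summable_sum summable_mult pd)
    have "(\<Sum>k. b n (\<phi> k) * d k) = (\<Sum>i<N. \<Sum>k. b n i * (if \<phi> k = i then d k else 0))"
      unfolding rearrange by (intro suminf_sum summable_mult pd)
    also have "\<dots> = (\<Sum>i<N. b n i * (\<Phi> j i - \<Phi> j' i))"
    proof (rule sum.cong[OF refl])
      fix i
      have "\<Phi> j i - \<Phi> j' i = (\<Sum>k. (if \<phi> k = i then x j k else 0) - (if \<phi> k = i then x j' k else 0))"
        unfolding \<Phi>_def by (rule suminf_diff; rule summable_norm_cancel[OF part[OF x(1)]])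
      also have "\<dots> = (\<Sum>k. if \<phi> k = i then d k else 0)"
        by (intro suminf_cong) (simp add: d_def)
      finally show "(\<Sum>k. b n i * (if \<phi> k = i then d k else 0)) = b n i * (\<Phi> j i - \<Phi> j' i)"
        using suminf_mult[OF pd, of "b n i" i] by simp
    qed
    finally have "norm (\<Sum>k. b n (\<phi> k) * d k) \<le> (\<Sum>i<N. C * norm (\<Phi> j i - \<Phi> j' i))"
      by (auto simp: norm_mult intro!: sum_norm_le mult_right_mono entry_bound)
    then have second: "norm (\<Sum>k. b n (\<phi> k) * d k) \<le> C * (\<Sum>i<N. norm (\<Phi> j i - \<Phi> j' i))"
      by (simp add: sum_distrib_left)
    have "mat_op b (x j) n - mat_op b (x j') n = mat_op b d n"
      unfolding d_def by (rule mat_op_minus[OF x(1) x(1), symmetric])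
    also have "\<dots> = (\<Sum>k. (b n k - b n (\<phi> k)) * d k) + (\<Sum>k. b n (\<phi> k) * d k)"
      unfolding mat_op_def suminf_add[OF summable_norm_cancel[OF s1] s2]
      by (simp add: algebra_simps)
    finally show ?thesis
      using norm_triangle_ineq[of "\<Sum>k. (b n k - b n (\<phi> k)) * d k" "\<Sum>k. b n (\<phi> k) * d k"] first second
      by simp
  qed
  ultimately show "\<exists>(N::nat) K (\<Phi> :: nat \<Rightarrow> nat \<Rightarrow> complex) B. (\<forall>j i. norm (\<Phi> j i) \<le> B) \<and>
      (\<forall>j j' n. norm (mat_op b (x j) n - mat_op b (x j') n) \<le> e + K * (\<Sum>i<N. norm (\<Phi> j i - \<Phi> j' i)))"
    by (intro exI[of _ N] exI[of _ C] exI[of _ \<Phi>] exI[of _ D]) blast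
qed

end

section \<open>Both compactness criteria on the fractional difference spaces\<close>

theorem theorem3p9:
  fixes \<alpha> p q :: real and A :: cmatrix
  assumes "\<alpha> \<notin> \<int>" and "1 < p" and "q = p / (p - 1)"
  shows
    "(A \<in> mat_class (lp_diff \<alpha> p) linf \<longrightarrow>
       (compact_operator (lp_diff \<alpha> p) (lp_diff_norm \<alpha> p) linf linf_norm (mat_op A) \<longleftrightarrow>
        (\<lambda>r. SUP n. (\<Sum>k. norm (hat_mat \<alpha> A n (r + 1 + k)) powr q) powr (1 / q))
          \<longlonglongrightarrow> 0)) \<and>
     (A \<in> mat_class (lp_diff \<alpha> 1) linf \<longrightarrow>
       (compact_operator (lp_diff \<alpha> 1) (lp_diff_norm \<alpha> 1) linf linf_norm (mat_op A) \<longleftrightarrow>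
        uniform_limit UNIV
          (\<lambda>m (k1, k2). SUP n\<in>{0..m}. norm (hat_mat \<alpha> A n k1 - hat_mat \<alpha> A n k2))
          (\<lambda>(k1, k2). SUP n. norm (hat_mat \<alpha> A n k1 - hat_mat \<alpha> A n k2))
          sequentially))"
proof (intro conjI impI)
  assume A: "A \<in> mat_class (lp_diff \<alpha> p) linf"
  note transfer = mat_class_lp_diff_linf[OF assms(1) less_imp_le[OF assms(2)] A]
  obtain C where "bounded_matrix p C (hat_mat \<alpha> A)"
    using transfer(1) ..
  from bounded_matrix.compact_iff_tails[OF this assms(2,3)]
  show "compact_operator (lp_diff \<alpha> p) (lp_diff_norm \<alpha> p) linf linf_norm (mat_op A) \<longleftrightarrow>
      (\<lambda>r. SUP n. (\<Sum>k. norm (hat_mat \<alpha> A n (r + 1 + k)) powr q) powr (1 / q)) \<longlonglongrightarrow> 0"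
    unfolding transfer(2) lp_norm_def[of q] .
next
  assume A: "A \<in> mat_class (lp_diff \<alpha> 1) linf"
  note transfer = mat_class_lp_diff_linf[OF assms(1) order_refl A]
  obtain C where "bounded_matrix 1 C (hat_mat \<alpha> A)"
    using transfer(1) ..
  then interpret bounded_matrix 1 C "hat_mat \<alpha> A" .
  show "compact_operator (lp_diff \<alpha> 1) (lp_diff_norm \<alpha> 1) linf linf_norm (mat_op A) \<longleftrightarrow>
      uniform_limit UNIV
        (\<lambda>m (k1, k2). SUP n\<in>{0..m}. norm (hat_mat \<alpha> A n k1 - hat_mat \<alpha> A n k2))
        (\<lambda>(k1, k2). SUP n. norm (hat_mat \<alpha> A n k1 - hat_mat \<alpha> A n k2))
        sequentially"
    unfolding transfer(2) column_gap_def[symmetric] uniform_limit_column_gap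
    using compact_imp_column_gap compact_if_column_gap[OF refl] by blast
qed

end
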